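(* Let $\sigma\in L^1_\alpha(\mathcal X)$, $\varphi\in L^\infty_\alpha(\mathbb R^{d+1}_+)$ and $\psi\in L^1_\alpha(\mathbb R^{d+1}_+)$. Then the two-wavelet localization operator $\mathcal L_{\varphi,\psi}(\sigma)$ is a bounded linear operator from $L^1_\alpha(\mathbb R^{d+1}_+)$ into itself, and $$\|\mathcal L_{\varphi,\psi}(\sigma)\|_{\mathcal B(L^1_\alpha(\mathbb R^{d+1}_+))}\le \|\varphi\|_{\alpha,\infty}\,\|\psi\|_{\alpha,1}\,\|\sigma\|_{L^1_\alpha(\mathcal X)}.$$
   Context: Fix an integer $d\ge 1$ and a real $\alpha>-1/2$. Let $\mathbb R^{d+1}_+=\mathbb R^d\times(0,\infty)$, with points $x=(x',x_{d+1})$, equipped with the measure $$d\mu_\alpha(x)=\frac{x_{d+1}^{2\alpha+1}}{(2\pi)^d2^{2\alpha}\Gamma^2(\alpha+1)}\,dx.$$ For $1\le p\le\infty$, $L^p_\alpha(\mathbb R^{d+1}_+)$ is the $L^p$ space of complex-valued functions for $\mu_\alpha$, with norm $\|\cdot\|_{\alpha,p}$; $\mathcal B(E)$ denotes the bounded linear operators on a Banach space $E$ and $\|\cdot\|_{\mathcal B(E)}$ the operator norm. Let $\mathcal X=\{(a,x): a>0,\ x\in\mathbb R^{d+1}_+\}$ with measure $d\mu_\alpha(a,x)=\frac{d\mu_\alpha(x)\,da}{a^{2\alpha+d+3}}$, and $L^p_\alpha(\mathcal X)$ the corresponding $L^p$ space with norm $\|\cdot\|_{L^p_\alpha(\mathcal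 X)}$. Generalized translation, for $x,y\in\mathbb R^{d+1}_+$: $$\tau^\alpha_x\varphi(y)=\frac{\Gamma(\alpha+1)}{\sqrt\pi\,\Gamma(\alpha+1/2)}\int_0^\pi\varphi\Big(x'+y',\sqrt{x_{d+1}^2+y_{d+1}^2+2x_{d+1}y_{d+1}\cos\theta}\Big)(\sin\theta)^{2\alpha}\,d\theta;$$ it extends to a contraction on every $L^p_\alpha(\mathbb R^{d+1}_+)$. For $a>0$ put $\varphi_a(x)=a^{-(2\alpha+d+2)}\varphi(x/a)$ and $\varphi_{a,x}(y)=a^{\alpha+1+\frac d2}\,\tau^\alpha_x\varphi_a(y)$. Weinstein continuous wavelet transform (for $f$ and $\varphi$ in Lebesgue spaces with conjugate exponents): $$\Phi^W_\varphi(f)(a,x)=\int_{\mathbb R^{d+1}_+}f(y)\,\overline{\varphi_{a,x}(y)}\,d\mu_\alpha(y),\quad (a,x)\in\mathcal X.$$ Two-wavelet localization operator with symbol $\sigma$ (measurable on $\mathcal X$) and windows $\varphi,\psi$ (measurable on $\mathbb R^{d+1}_+$): $$\mathcal L_{\varphi,\psi}(\sigma)(f)(y)=\int_{\mathcal X}\sigma(a,x)\,\Phi^W_\varphi(f)(a,x)\,\psi_{a,x}(y)\,d\mu_\alpha(a,x),\quad y\in\mathbb R^{d+1}_+.$$ *)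

theory Defs
  imports "HOL-Probability.Essential_Supremum" "HOL-Analysis.Analysis"
begin

text \<open>
  Elements of an \<open>L\<^sup>p\<close> space are represented by measurable complex functions; the identification
  of functions agreeing almost everywhere is made explicit in the definition of bounded linear
  operators below. The exponent ranges over \<open>[1, \<infinity>]\<close>.
\<close>

definition Lp_space :: "ennreal \<Rightarrow> 'a measure \<Rightarrow> ('a \<Rightarrow> complex) set" where
  "Lp_space p M = {f \<in> borel_measurable M.
     if p = \<infinity> then esssup M (\<lambda>x. ennreal (norm (f x))) < \<infinity>
     else integrable M (\<lambda>x. norm (f x) powr enn2real p)}"

definition Lp_norm :: "ennreal \<Rightarrow> 'a measure \<Rightarrow> ('a \<Rightarrow> complex) \<Rightarrow> real" where
  "Lp_norm p M f =
     (if p = \<infinity> then enn2real (esssup M (\<lambda>x. ennreal (norm (f x))))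
      else (\<integral>x. norm (f x) powr enn2real p \<partial>M) powr (1 / enn2real p))"

text \<open>
  \<open>T\<close> induces a bounded complex-linear operator of \<open>L\<^sup>p(M)\<close>, viewed as a space of classes
  modulo almost everywhere equality, into itself.
\<close>

definition Lp_bounded_linear ::
    "ennreal \<Rightarrow> 'a measure \<Rightarrow> (('a \<Rightarrow> complex) \<Rightarrow> 'a \<Rightarrow> complex) \<Rightarrow> bool" where
  "Lp_bounded_linear p M T \<longleftrightarrow>
     (\<forall>f\<in>Lp_space p M. T f \<in> Lp_space p M) \<and>
     (\<forall>f\<in>Lp_space p M. \<forall>g\<in>Lp_space p M.
        (AE x in M. f x = g x) \<longrightarrow> (AE x in M. T f x = T g x)) \<and>
     (\<forall>f\<in>Lp_space p M. \<forall>g\<in>Lp_space p M.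
        AE x in M. T (\<lambda>y. f y + g y) x = T f x + T g x) \<and>
     (\<forall>c. \<forall>f\<in>Lp_space p M. AE x in M. T (\<lambda>y. c * f y) x = c * T f x) \<and>
     (\<exists>C. \<forall>f\<in>Lp_space p M. Lp_norm p M (T f) \<le> C * Lp_norm p M f)"

text \<open>
  The analogue of \<^const>\<open>onorm\<close>. As there, the quotient is \<open>0\<close> for \<open>\<parallel>f\<parallel> = 0\<close>, and the supremum
  is meaningful only for bounded operators.
\<close>

definition Lp_onorm ::
    "ennreal \<Rightarrow> 'a measure \<Rightarrow> (('a \<Rightarrow> complex) \<Rightarrow> 'a \<Rightarrow> complex) \<Rightarrow> real" where
  "Lp_onorm p M T = (SUP f\<in>Lp_space p M. Lp_norm p M (T f) / Lp_norm p M f)"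

text \<open>A point \<open>(x', x\<^bsub>d+1\<^esub>)\<close> is a pair in \<^typ>\<open>(real^'d) \<times> real\<close>, where \<open>d = CARD('d) \<ge> 1\<close>.\<close>

definition half_space :: "((real^'d) \<times> real) set" where
  "half_space = {x. 0 < snd x}"

definition weinstein_measure :: "real \<Rightarrow> ((real^'d) \<times> real) measure" where
  "weinstein_measure \<alpha> = density (restrict_space lborel half_space)
     (\<lambda>x. ennreal (snd x powr (2 * \<alpha> + 1)
        / ((2 * pi) ^ CARD('d) * 2 powr (2 * \<alpha>) * (Gamma (\<alpha> + 1))\<^sup>2)))"

definition weinstein_phase_measure :: "real \<Rightarrow> (real \<times> ((real^'d) \<times> real)) measure" where
  "weinstein_phase_measure \<alpha> =
     density (restrict_space lborel {0<..} \<Otimes>\<^sub>M weinstein_measure \<alpha>)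
       (\<lambda>(a, x). ennreal (1 / a powr (2 * \<alpha> + real CARD('d) + 3)))"

text \<open>
  For \<open>\<phi>\<close> in any \<open>L\<^sup>p\<close> space and \<open>x\<close> in the half space, the integral converges absolutely for almost
  every \<open>y\<close>, and up to null sets the result depends only on the class of \<open>\<phi>\<close>. So this
  formula also gives the extension of the generalized translation to \<open>L\<^sup>p\<close>.
\<close>

definition weinstein_translation ::
    "real \<Rightarrow> (real^'d) \<times> real \<Rightarrow> ((real^'d) \<times> real \<Rightarrow> complex)
       \<Rightarrow> (real^'d) \<times> real \<Rightarrow> complex" where
  "weinstein_translation \<alpha> x \<phi> y =
     of_real (Gamma (\<alpha> + 1) / (sqrt pi * Gamma (\<alpha> + 1/2))) *
     (LBINT \<theta>=0..pi.
        \<phi> (fst x + fst y, sqrt ((snd x)\<^sup>2 + (snd y)\<^sup>2 + 2 * snd x * snd y * cos \<theta>))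
        * of_real (sin \<theta> powr (2 * \<alpha>)))"

definition weinstein_dilation ::
    "real \<Rightarrow> real \<Rightarrow> ((real^'d) \<times> real \<Rightarrow> complex) \<Rightarrow> (real^'d) \<times> real \<Rightarrow> complex" where
  "weinstein_dilation \<alpha> a \<phi> x =
     of_real (a powr (- (2 * \<alpha> + real CARD('d) + 2))) * \<phi> (x /\<^sub>R a)"

definition weinstein_wavelet ::
    "real \<Rightarrow> ((real^'d) \<times> real \<Rightarrow> complex) \<Rightarrow> real \<Rightarrow> (real^'d) \<times> real
       \<Rightarrow> (real^'d) \<times> real \<Rightarrow> complex" where
  "weinstein_wavelet \<alpha> \<phi> a x y =
     of_real (a powr (\<alpha> + 1 + real CARD('d) / 2))
       * weinstein_translation \<alpha> x (weinstein_dilation \<alpha> a \<phi>) y"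

definition weinstein_transform ::
    "real \<Rightarrow> ((real^'d) \<times> real \<Rightarrow> complex) \<Rightarrow> ((real^'d) \<times> real \<Rightarrow> complex)
       \<Rightarrow> real \<Rightarrow> (real^'d) \<times> real \<Rightarrow> complex" where
  "weinstein_transform \<alpha> \<phi> f a x =
     (\<integral>y. f y * cnj (weinstein_wavelet \<alpha> \<phi> a x y) \<partial>weinstein_measure \<alpha>)"

definition localization_operator ::
    "real \<Rightarrow> ((real^'d) \<times> real \<Rightarrow> complex) \<Rightarrow> ((real^'d) \<times> real \<Rightarrow> complex)
       \<Rightarrow> (real \<times> ((real^'d) \<times> real) \<Rightarrow> complex)
       \<Rightarrow> ((real^'d) \<times> real \<Rightarrow> complex) \<Rightarrow> (real^'d) \<times> real \<Rightarrow> complex" where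
  "localization_operator \<alpha> \<phi> \<psi> \<sigma> f y =
     (\<integral>(a, x). \<sigma> (a, x) * weinstein_transform \<alpha> \<phi> f a x * weinstein_wavelet \<alpha> \<psi> a x y
        \<partial>weinstein_phase_measure \<alpha>)"

text \<open>
  Bochner integrals of non-integrable functions are \<open>0\<close>, so the convergence of the integrals
  defining the localization operator at \<open>f\<close> is recorded separately.
\<close>

definition localization_defined ::
    "real \<Rightarrow> ((real^'d) \<times> real \<Rightarrow> complex) \<Rightarrow> ((real^'d) \<times> real \<Rightarrow> complex)
       \<Rightarrow> (real \<times> ((real^'d) \<times> real) \<Rightarrow> complex)
       \<Rightarrow> ((real^'d) \<times> real \<Rightarrow> complex) \<Rightarrow> bool" where
  "localization_defined \<alpha> \<phi> \<psi> \<sigma> f \<longleftrightarrow>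
     (\<forall>a>0. \<forall>x\<in>half_space.
        integrable (weinstein_measure \<alpha>) (\<lambda>y. f y * cnj (weinstein_wavelet \<alpha> \<phi> a x y))) \<and>
     (AE y in weinstein_measure \<alpha>.
        integrable (weinstein_phase_measure \<alpha>)
          (\<lambda>(a, x). \<sigma> (a, x) * weinstein_transform \<alpha> \<phi> f a x * weinstein_wavelet \<alpha> \<psi> a x y))"

end

theory Submission
  imports Defs
begin

text \<open>
  The estimate rests on two bounds for the wavelets, with \<open>e = \<alpha> + 1 + d/2\<close>:
  \<open>|\<phi>\<^bsub>a,x\<^esub>| \<le> a\<^bsup>-e\<^esup> \<parallel>\<phi>\<parallel>\<^sub>\<infinity>\<close> almost everywhere, and \<open>\<parallel>\<psi>\<^bsub>a,x\<^esub>\<parallel>\<^sub>1 \<le> a\<^bsup>e\<^esup> \<parallel>\<psi>\<parallel>\<^sub>1\<close>.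
  The first one gives \<open>|\<Phi>\<^sub>\<phi>(f)(a,x)| \<le> a\<^bsup>-e\<^esup> \<parallel>\<phi>\<parallel>\<^sub>\<infinity> \<parallel>f\<parallel>\<^sub>1\<close>. When the absolute value of the
  integrand of the localization operator is integrated over \<open>y\<close> before \<open>(a, x)\<close>, the two powers
  of \<open>a\<close> cancel and \<open>\<parallel>\<phi>\<parallel>\<^sub>\<infinity> \<parallel>\<psi>\<parallel>\<^sub>1 \<parallel>\<sigma>\<parallel>\<^sub>1 \<parallel>f\<parallel>\<^sub>1\<close> remains. By Fubini's theorem this single estimate gives
  convergence, boundedness and the norm bound. Nothing in this step depends on the form of the
  wavelets, so it is carried out for arbitrary kernels (\<open>two_kernel_operator\<close>).

  Both wavelet bounds come from one identity: the translation of a nonnegative function has the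
  same \<open>\<mu>\<^sub>\<alpha>\<close>-integral as the function (\<open>nn_integral_nn_translation\<close>). For the last coordinate, read
  \<open>(t, \<theta>)\<close> as polar coordinates in the upper half plane, \<open>(u, v) = (t cos \<theta>, t sin \<theta>)\<close>. The measure
  \<open>(sin \<theta>)\<^bsup>2\<alpha>\<^esup> t\<^bsup>2\<alpha>+1\<^esup> d\<theta> dt\<close> is then \<open>v\<^bsup>2\<alpha>\<^esup> du dv\<close>, and
  \<open>s\<^sup>2 + t\<^sup>2 + 2 s t cos \<theta> = (s + u)\<^sup>2 + v\<^sup>2\<close>. So translation by \<open>s\<close> becomes a shift of \<open>u\<close>, which
  preserves \<open>v\<^bsup>2\<alpha>\<^esup> du dv\<close>. The constant in front of the translation is normalized by the
  Beta integral (\<open>nn_integral_sin_powr\<close>).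

  The \<open>L\<^sup>\<infinity>\<close> bound needs the same identity, because \<open>\<phi>\<close> is bounded only almost everywhere: applied to
  the indicator of the exceptional null set, it shows that for almost every \<open>y\<close> the averaging in the
  translation avoids that set (\<open>AE_norm_weinstein_wavelet_le\<close>).
\<close>

section \<open>Polar coordinates in the upper half plane\<close>

text \<open>
  Monotone convergence reduces the claim to the substitution rule on compact intervals: the intervals
  \<open>[-n, n]\<close> and \<open>[- arctan n, arctan n]\<close> correspond to each other under \<open>tan\<close> and exhaust the two
  domains of integration.
\<close>

lemma nn_integral_tan_substitution:
  fixes f :: "real \<Rightarrow> ennreal"
  assumes [measurable]: "f \<in> borel_measurable borel"
  shows "(\<integral>\<^sup>+w. f w \<partial>lborel)
    = (\<integral>\<^sup>+\<phi>. f (tan \<phi>) * ennreal (inverse ((cos \<phi>)\<^sup>2)) * indicator {-pi/2<..<pi/2} \<phi> \<partial>lborel)"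
proof -
  define A where "A n = {- real n..real n}" for n :: nat
  define B where "B n = {- arctan (real n)..arctan (real n)}" for n :: nat
  have incA: "incseq (\<lambda>n w. f w * indicator (A n) w)"
    by (auto simp: incseq_def le_fun_def A_def split: split_indicator intro!: mult_left_mono)
  have incB: "incseq (\<lambda>n \<phi>. f (tan \<phi>) * ennreal (inverse ((cos \<phi>)\<^sup>2)) * indicator (B n) \<phi>)"
  proof -
    have "B m \<subseteq> B n" if "m \<le> n" for m n
    proof -
      have "arctan (real m) \<le> arctan (real n)"
        using that by (simp add: arctan_le_iff)
      then show ?thesis
        by (auto simp: B_def)
    qed
    then show ?thesis
      by (auto simp: incseq_def le_fun_def intro!: mult_left_mono indicator_leI)
  qed
  have supA: "(SUP n. indicator (A n) w) = (1::ennreal)" for w :: real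
  proof -
    obtain n :: nat where "\<bar>w\<bar> \<le> real n"
      using real_arch_simple by blast
    then have "indicator (A n) w = (1::ennreal)"
      by (simp add: A_def indicator_def abs_le_iff)
    then have "1 \<le> (SUP n. indicator (A n) w :: ennreal)"
      by (metis SUP_upper UNIV_I)
    then show ?thesis
      by (intro antisym SUP_least) (auto split: split_indicator)
  qed
  have supB: "(SUP n. indicator (B n) \<phi>) = (indicator {-pi/2<..<pi/2} \<phi> :: ennreal)" for \<phi> :: real
  proof (cases "\<phi> \<in> {-pi/2<..<pi/2}")
    case True
    obtain n :: nat where n: "\<bar>tan \<phi>\<bar> \<le> real n"
      using real_arch_simple by blast
    have "arctan (- real n) \<le> arctan (tan \<phi>)" "arctan (tan \<phi>) \<le> arctan (real n)"
      using n by (auto simp only: arctan_le_iff)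
    then have "indicator (B n) \<phi> = (1::ennreal)"
      using True by (simp add: B_def arctan_tan arctan_minus)
    then have "1 \<le> (SUP n. indicator (B n) \<phi> :: ennreal)"
      by (metis SUP_upper UNIV_I)
    with True show ?thesis
      by (intro antisym SUP_least) (auto split: split_indicator)
  next
    case False
    have "\<phi> \<notin> B n" for n
    proof
      assume "\<phi> \<in> B n"
      then have "- arctan (real n) \<le> \<phi>" "\<phi> \<le> arctan (real n)"
        by (auto simp: B_def)
      then show False
        using False arctan_bounded[of "real n"] by auto
    qed
    with False show ?thesis
      by simp
  qed
  have step: "(\<integral>\<^sup>+w. f w * indicator (A n) w \<partial>lborel)
    = (\<integral>\<^sup>+\<phi>. f (tan \<phi>) * ennreal (inverse ((cos \<phi>)\<^sup>2)) * indicator (B n) \<phi> \<partial>lborel)" for n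
  proof (cases "n = 0")
    case True
    have "(\<integral>\<^sup>+w. g w * indicator {0::real} w \<partial>lborel) = 0" for g :: "real \<Rightarrow> ennreal"
    proof -
      have "AE w in lborel. w \<noteq> (0::real)"
        by (rule AE_lborel_singleton)
      then have "(\<integral>\<^sup>+w. g w * indicator {0::real} w \<partial>lborel) = (\<integral>\<^sup>+(w::real). 0 \<partial>lborel)"
        by (intro nn_integral_cong_AE) auto
      then show ?thesis by simp
    qed
    moreover have "A n = {0}" "B n = {0}"
      using True by (auto simp: A_def B_def)
    ultimately show ?thesis
      by simp
  next
    case False
    have cos_pos: "cos \<phi> > 0" if "\<phi> \<in> {- arctan (real n)..arctan (real n)}" for \<phi>
      using that arctan_bounded[of "real n"] by (intro cos_gt_zero_pi) auto
    have "(\<integral>\<^sup>+w. f w * indicator {tan (- arctan (real n))..tan (arctan (real n))} w \<partial>lborel)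
      = (\<integral>\<^sup>+\<phi>. f (tan \<phi>) * ennreal (inverse ((cos \<phi>)\<^sup>2)) * indicator (B n) \<phi> \<partial>lborel)"
      unfolding B_def
    proof (rule nn_integral_substitution_aux)
      show "(tan has_real_derivative inverse ((cos \<phi>)\<^sup>2)) (at \<phi>)"
        if "\<phi> \<in> {- arctan (real n)..arctan (real n)}" for \<phi>
        using cos_pos[OF that] by (intro DERIV_tan) simp
      show "continuous_on {- arctan (real n)..arctan (real n)} (\<lambda>\<phi>. inverse ((cos \<phi>)\<^sup>2))"
        using cos_pos by (intro continuous_intros) force
      show "- arctan (real n) < arctan (real n)"
        using False by simp
    qed auto
    then show ?thesis
      by (simp add: A_def tan_arctan)
  qed
  have "(\<integral>\<^sup>+w. f w \<partial>lborel) = (\<integral>\<^sup>+w. (SUP n. f w * indicator (A n) w) \<partial>lborel)"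
    by (simp add: SUP_mult_left_ennreal[symmetric] supA)
  also have "\<dots> = (SUP n. \<integral>\<^sup>+w. f w * indicator (A n) w \<partial>lborel)"
    using incA by (rule nn_integral_monotone_convergence_SUP) (auto simp: A_def)
  also have "\<dots> = (SUP n. \<integral>\<^sup>+\<phi>. f (tan \<phi>) * ennreal (inverse ((cos \<phi>)\<^sup>2)) * indicator (B n) \<phi> \<partial>lborel)"
    by (simp only: step)
  also have "\<dots> = (\<integral>\<^sup>+\<phi>. (SUP n. f (tan \<phi>) * ennreal (inverse ((cos \<phi>)\<^sup>2)) * indicator (B n) \<phi>) \<partial>lborel)"
    using incB by (rule nn_integral_monotone_convergence_SUP[symmetric]) (auto simp: B_def tan_def)
  also have "\<dots> = (\<integral>\<^sup>+\<phi>. f (tan \<phi>) * ennreal (inverse ((cos \<phi>)\<^sup>2)) * indicator {-pi/2<..<pi/2} \<phi> \<partial>lborel)"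
    by (simp add: SUP_mult_left_ennreal[symmetric] supB)
  finally show ?thesis .
qed

text \<open>
  Three one-dimensional substitutions suffice: \<open>u = v w\<close> for fixed \<open>v\<close>; then, after an exchange of
  integrals, \<open>v = r / sqrt (1 + w\<^sup>2)\<close> for fixed \<open>w\<close>; and, after another exchange, \<open>w = tan \<phi>\<close> for
  fixed \<open>r\<close>. Here \<open>\<phi> = pi/2 - \<theta>\<close> is the angle to the vertical axis.
\<close>

lemma nn_integral_polar_half_plane:
  fixes F :: "real \<times> real \<Rightarrow> ennreal"
  assumes [measurable]: "F \<in> borel_measurable borel"
  shows "(\<integral>\<^sup>+v\<in>{0<..}. (\<integral>\<^sup>+u. F (u, v) \<partial>lborel) \<partial>lborel)
    = (\<integral>\<^sup>+r\<in>{0<..}. (\<integral>\<^sup>+\<theta>\<in>{0<..<pi}. F (r * cos \<theta>, r * sin \<theta>) \<partial>lborel) * ennreal r \<partial>lborel)"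
proof -
  have [measurable]: "(\<lambda>(u, v). F (u, v)) \<in> borel_measurable (borel \<Otimes>\<^sub>M borel)"
    by (simp add: borel_prod)
  \<comment> \<open>In terms of the slope \<open>w = tan \<phi>\<close>, this is \<open>cos \<phi>\<close>.\<close>
  define k where "k w = 1 / sqrt (1 + w\<^sup>2)" for w :: real
  have k_pos: "k w > 0" for w
    unfolding k_def by (simp add: add_pos_nonneg)
  have [measurable]: "k \<in> borel_measurable borel"
    unfolding k_def by measurable
  have shear: "(\<integral>\<^sup>+u. F (u, v) \<partial>lborel) = ennreal v * (\<integral>\<^sup>+w. F (v * w, v) \<partial>lborel)" if "v > 0" for v
    using that by (subst nn_integral_real_affine[where c = v and t = 0]) auto
  have scale: "(\<integral>\<^sup>+v. F (v * w, v) * ennreal v * indicator {0<..} v \<partial>lborel)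
    = (\<integral>\<^sup>+r. F (r * (k w * w), r * k w) * ennreal r * indicator {0<..} r * ennreal ((k w)\<^sup>2) \<partial>lborel)" for w
  proof -
    have "(\<integral>\<^sup>+v. F (v * w, v) * ennreal v * indicator {0<..} v \<partial>lborel)
      = ennreal (k w) * (\<integral>\<^sup>+r. F (k w * r * w, k w * r) * ennreal (k w * r) * indicator {0<..} (k w * r) \<partial>lborel)"
      using k_pos[of w] by (subst nn_integral_real_affine[where c = "k w" and t = 0]) auto
    also have "\<dots> = (\<integral>\<^sup>+r. ennreal (k w) * (F (k w * r * w, k w * r) * ennreal (k w * r) * indicator {0<..} (k w * r)) \<partial>lborel)"
      by (rule nn_integral_cmult[symmetric]) measurable
    also have "\<dots> = (\<integral>\<^sup>+r. F (r * (k w * w), r * k w) * ennreal r * indicator {0<..} r * ennreal ((k w)\<^sup>2) \<partial>lborel)"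
      using k_pos[of w]
      by (intro nn_integral_cong)
        (auto simp: zero_less_mult_iff ennreal_mult' power2_eq_square mult_ac split: split_indicator)
    finally show ?thesis .
  qed
  have angle: "(\<integral>\<^sup>+w. F (r * (k w * w), r * k w) * ennreal ((k w)\<^sup>2) \<partial>lborel)
    = (\<integral>\<^sup>+\<theta>\<in>{0<..<pi}. F (r * cos \<theta>, r * sin \<theta>) \<partial>lborel)" for r
  proof -
    have k_tan: "k (tan \<phi>) = cos \<phi>" if "\<phi> \<in> {-pi/2<..<pi/2}" for \<phi>
    proof -
      have c: "cos \<phi> > 0"
        using that by (intro cos_gt_zero_pi) auto
      then have "1 + (tan \<phi>)\<^sup>2 = (1 / cos \<phi>)\<^sup>2"
        by (simp add: tan_sec power_divide inverse_eq_divide)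
      with c show ?thesis
        by (simp add: k_def real_sqrt_divide)
    qed
    have "(\<integral>\<^sup>+w. F (r * (k w * w), r * k w) * ennreal ((k w)\<^sup>2) \<partial>lborel)
      = (\<integral>\<^sup>+\<phi>. F (r * (k (tan \<phi>) * tan \<phi>), r * k (tan \<phi>)) * ennreal ((k (tan \<phi>))\<^sup>2)
            * ennreal (inverse ((cos \<phi>)\<^sup>2)) * indicator {-pi/2<..<pi/2} \<phi> \<partial>lborel)"
      by (rule nn_integral_tan_substitution) measurable
    also have "\<dots> = (\<integral>\<^sup>+\<phi>. F (r * sin \<phi>, r * cos \<phi>) * indicator {-pi/2<..<pi/2} \<phi> \<partial>lborel)"
    proof (intro nn_integral_cong)
      fix \<phi> :: real
      show "F (r * (k (tan \<phi>) * tan \<phi>), r * k (tan \<phi>)) * ennreal ((k (tan \<phi>))\<^sup>2)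
            * ennreal (inverse ((cos \<phi>)\<^sup>2)) * indicator {-pi/2<..<pi/2} \<phi>
          = F (r * sin \<phi>, r * cos \<phi>) * indicator {-pi/2<..<pi/2} \<phi>"
      proof (cases "\<phi> \<in> {-pi/2<..<pi/2}")
        case True
        then have "cos \<phi> > 0"
          by (intro cos_gt_zero_pi) auto
        then have "cos \<phi> * tan \<phi> = sin \<phi>"
          "ennreal ((cos \<phi>)\<^sup>2) * ennreal (inverse ((cos \<phi>)\<^sup>2)) = 1"
          by (auto simp: tan_def ennreal_mult'[symmetric])
        then show ?thesis
          using True by (simp add: k_tan mult.assoc)
      qed simp
    qed
    also have "\<dots> = (\<integral>\<^sup>+\<theta>. F (r * sin (pi/2 + (-1) * \<theta>), r * cos (pi/2 + (-1) * \<theta>))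
          * indicator {-pi/2<..<pi/2} (pi/2 + (-1) * \<theta>) \<partial>lborel)"
      by (subst nn_integral_real_affine[where c = "-1" and t = "pi/2"]) auto
    also have "\<dots> = (\<integral>\<^sup>+\<theta>\<in>{0<..<pi}. F (r * cos \<theta>, r * sin \<theta>) \<partial>lborel)"
      by (intro nn_integral_cong) (auto simp: sin_diff cos_diff split: split_indicator)
    finally show ?thesis .
  qed
  have "(\<integral>\<^sup>+v\<in>{0<..}. (\<integral>\<^sup>+u. F (u, v) \<partial>lborel) \<partial>lborel)
    = (\<integral>\<^sup>+v. (\<integral>\<^sup>+w. F (v * w, v) * ennreal v * indicator {0<..} v \<partial>lborel) \<partial>lborel)"
  proof (intro nn_integral_cong)
    fix v :: real
    have "(\<integral>\<^sup>+w. F (v * w, v) * ennreal v * indicator {0<..} v \<partial>lborel)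
      = (\<integral>\<^sup>+w. F (v * w, v) * (ennreal v * indicator {0<..} v) \<partial>lborel)"
      by (simp add: mult.assoc)
    also have "\<dots> = (\<integral>\<^sup>+w. F (v * w, v) \<partial>lborel) * (ennreal v * indicator {0<..} v)"
      by (rule nn_integral_multc) measurable
    finally show "(\<integral>\<^sup>+u. F (u, v) \<partial>lborel) * indicator {0<..} v
      = (\<integral>\<^sup>+w. F (v * w, v) * ennreal v * indicator {0<..} v \<partial>lborel)"
      using shear[of v] by (auto simp: mult_ac split: split_indicator)
  qed
  also have "\<dots> = (\<integral>\<^sup>+w. (\<integral>\<^sup>+v. F (v * w, v) * ennreal v * indicator {0<..} v \<partial>lborel) \<partial>lborel)"
    by (rule lborel_pair.Fubini') measurable
  also have "\<dots> = (\<integral>\<^sup>+w. (\<integral>\<^sup>+r. F (r * (k w * w), r * k w) * ennreal r * indicator {0<..} r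
        * ennreal ((k w)\<^sup>2) \<partial>lborel) \<partial>lborel)"
    by (simp only: scale)
  also have "\<dots> = (\<integral>\<^sup>+r. (\<integral>\<^sup>+w. F (r * (k w * w), r * k w) * ennreal r * indicator {0<..} r
        * ennreal ((k w)\<^sup>2) \<partial>lborel) \<partial>lborel)"
    by (rule lborel_pair.Fubini') measurable
  also have "\<dots> = (\<integral>\<^sup>+r\<in>{0<..}. (\<integral>\<^sup>+\<theta>\<in>{0<..<pi}. F (r * cos \<theta>, r * sin \<theta>) \<partial>lborel) * ennreal r \<partial>lborel)"
  proof (intro nn_integral_cong)
    fix r :: real
    have "(\<integral>\<^sup>+w. F (r * (k w * w), r * k w) * ennreal r * indicator {0<..} r * ennreal ((k w)\<^sup>2) \<partial>lborel)
      = (\<integral>\<^sup>+w. F (r * (k w * w), r * k w) * ennreal ((k w)\<^sup>2) * (ennreal r * indicator {0<..} r) \<partial>lborel)"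
      by (simp add: mult_ac)
    also have "\<dots> = (\<integral>\<^sup>+w. F (r * (k w * w), r * k w) * ennreal ((k w)\<^sup>2) \<partial>lborel) * (ennreal r * indicator {0<..} r)"
      by (rule nn_integral_multc) measurable
    finally show "(\<integral>\<^sup>+w. F (r * (k w * w), r * k w) * ennreal r * indicator {0<..} r * ennreal ((k w)\<^sup>2) \<partial>lborel)
      = (\<integral>\<^sup>+\<theta>\<in>{0<..<pi}. F (r * cos \<theta>, r * sin \<theta>) \<partial>lborel) * ennreal r * indicator {0<..} r"
      by (simp add: angle mult.assoc)
  qed
  finally show ?thesis .
qed

text \<open>
  The substitution \<open>t = (1 - cos \<theta>) / 2\<close> turns \<open>t (1 - t)\<close> into \<open>(sin \<theta>)\<^sup>2 / 4\<close> and is monotone on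
  the whole interval. So the integral is a multiple of \<open>B(\<alpha> + 1/2, \<alpha> + 1/2)\<close>, and Legendre's
  duplication formula removes the factor \<open>\<Gamma>(2 \<alpha> + 1)\<close>.
\<close>

lemma nn_integral_sin_powr:
  fixes \<alpha> :: real
  assumes "\<alpha> > - 1/2"
  shows "(\<integral>\<^sup>+\<theta>\<in>{0<..<pi}. ennreal (sin \<theta> powr (2 * \<alpha>)) \<partial>lborel)
    = ennreal (sqrt pi * Gamma (\<alpha> + 1/2) / Gamma (\<alpha> + 1))"
proof -
  define b where "b = \<alpha> + 1/2"
  have b: "b > 0" using assms by (simp add: b_def)
  let ?f = "\<lambda>t. t powr (b - 1) * (1 - t) powr (b - 1)"
  have "ennreal (Beta b b) = (\<integral>\<^sup>+t. ?f t * indicator {0..1} t \<partial>lborel)"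
    using nn_integral_has_integral_lebesgue'[OF _ has_integral_Beta_real[OF b b]]
    by (simp add: nn_integral_set_ennreal)
  also have "\<dots> = (\<integral>\<^sup>+t. ?f t * indicator {(1 - cos 0) / 2..(1 - cos pi) / 2} t \<partial>lborel)"
    by simp
  also have "\<dots> = (\<integral>\<^sup>+\<theta>. ?f ((1 - cos \<theta>) / 2) * (sin \<theta> / 2) * indicator {0..pi} \<theta> \<partial>lborel)"
  proof (rule nn_integral_substitution)
    show "((\<lambda>\<theta>. (1 - cos \<theta>) / 2) has_real_derivative sin \<theta> / 2) (at \<theta>)" for \<theta>
      by (auto intro!: derivative_eq_intros)
    show "continuous_on {0..pi} (\<lambda>\<theta>. sin \<theta> / 2)"
      by (intro continuous_intros) auto
  qed (auto simp: set_borel_measurable_def sin_ge_zero)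
  also have "\<dots> = (\<integral>\<^sup>+\<theta>. ennreal (2 powr (- 2 * \<alpha>)) * (ennreal (sin \<theta> powr (2 * \<alpha>)) * indicator {0<..<pi} \<theta>) \<partial>lborel)"
  proof (intro nn_integral_cong)
    fix \<theta> :: real
    show "ennreal (?f ((1 - cos \<theta>) / 2) * (sin \<theta> / 2) * indicator {0..pi} \<theta>)
      = ennreal (2 powr (- 2 * \<alpha>)) * (ennreal (sin \<theta> powr (2 * \<alpha>)) * indicator {0<..<pi} \<theta>)"
    proof (cases "\<theta> \<in> {0<..<pi}")
      case True
      then have s: "sin \<theta> > 0"
        by (intro sin_gt_zero) auto
      have "\<bar>cos \<theta>\<bar> \<le> 1" by simp
      then have "?f ((1 - cos \<theta>) / 2) = ((1 - cos \<theta>) / 2 * (1 - (1 - cos \<theta>) / 2)) powr (b - 1)"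
        by (subst powr_mult) (auto simp: field_simps)
      also have "(1 - cos \<theta>) / 2 * (1 - (1 - cos \<theta>) / 2) = (sin \<theta> / 2)\<^sup>2"
        by (simp add: sin_squared_eq power_divide) (simp add: field_simps power2_eq_square)
      also have "\<dots> powr (b - 1) * (sin \<theta> / 2) = (sin \<theta> / 2) powr (2 * (b - 1)) * (sin \<theta> / 2) powr 1"
        using s powr_powr[of "sin \<theta> / 2" 2 "b - 1"] by simp
      also have "\<dots> = (sin \<theta> / 2) powr (2 * \<alpha>)"
        by (subst powr_add[symmetric]) (simp add: b_def)
      also have "\<dots> = 2 powr (- 2 * \<alpha>) * sin \<theta> powr (2 * \<alpha>)"
        using s by (simp add: powr_divide powr_minus field_simps)
      finally show ?thesis
        using True by (simp add: ennreal_mult')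
    next
      case False
      then have "\<theta> \<in> {0..pi} \<Longrightarrow> \<theta> = 0 \<or> \<theta> = pi" by auto
      then show ?thesis
        using False by (auto split: split_indicator)
    qed
  qed
  also have "\<dots> = ennreal (2 powr (- 2 * \<alpha>)) * (\<integral>\<^sup>+\<theta>\<in>{0<..<pi}. ennreal (sin \<theta> powr (2 * \<alpha>)) \<partial>lborel)"
    by (rule nn_integral_cmult) measurable
  finally have eq: "ennreal (Beta b b)
    = ennreal (2 powr (- 2 * \<alpha>)) * (\<integral>\<^sup>+\<theta>\<in>{0<..<pi}. ennreal (sin \<theta> powr (2 * \<alpha>)) \<partial>lborel)" (is "_ = _ * ?I") .
  have dup: "Gamma b * Gamma (b + 1/2) = 2 powr (- 2 * \<alpha>) * sqrt pi * Gamma (2 * b)"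
  proof -
    have "of_real b \<notin> (\<int>\<^sub>\<le>\<^sub>0 :: complex set)" "of_real b + 1/2 \<notin> (\<int>\<^sub>\<le>\<^sub>0 :: complex set)"
      using b by (auto elim!: nonpos_Ints_cases simp: complex_eq_iff)
    from Gamma_legendre_duplication[OF this]
    have "complex_of_real (Gamma b * Gamma (b + 1/2))
        = of_real (exp ((1 - 2 * b) * ln 2) * sqrt pi * Gamma (2 * b))"
      by (simp add: Gamma_complex_of_real[symmetric] exp_of_real[symmetric] del: exp_of_real)
    then have "Gamma b * Gamma (b + 1/2) = exp ((1 - 2 * b) * ln 2) * sqrt pi * Gamma (2 * b)"
      by (simp only: of_real_eq_iff)
    then show ?thesis
      by (simp add: powr_def b_def algebra_simps)
  qed
  have "ennreal (2 powr (2 * \<alpha>)) * ennreal (Beta b b) = ?I"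
    unfolding eq by (simp add: mult.assoc[symmetric] ennreal_mult'[symmetric] powr_add[symmetric])
  moreover have "2 powr (2 * \<alpha>) * Beta b b = sqrt pi * Gamma (\<alpha> + 1/2) / Gamma (\<alpha> + 1)"
  proof -
    have "Gamma b > 0" "Gamma (b + 1/2) > 0" "Gamma (2 * b) > 0"
      using b by (auto intro!: Gamma_real_pos)
    with dup have "Beta b b * (2 powr (2 * \<alpha>) * Gamma (b + 1/2)) = sqrt pi * Gamma b"
      by (simp add: Beta_def powr_minus field_simps)
    then have "2 powr (2 * \<alpha>) * Beta b b = sqrt pi * Gamma b / Gamma (b + 1/2)"
      using \<open>Gamma (b + 1/2) > 0\<close> by (simp add: field_simps)
    also have "b + 1/2 = \<alpha> + 1"
      by (simp add: b_def)
    finally show ?thesis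
      by (simp only: b_def)
  qed
  ultimately show ?thesis
    by (simp add: ennreal_mult'[symmetric])
qed

text \<open>
  The one-dimensional core of the invariance of the measure under translation. In the Cartesian
  coordinates \<open>u = t cos \<theta>\<close>, \<open>v = t sin \<theta>\<close> the parameter \<open>s\<close> only shifts \<open>u\<close>, so the left-hand side
  is the same as for \<open>s = 0\<close>, where the integrand splits.
\<close>

lemma nn_integral_law_of_cosines:
  fixes h :: "real \<Rightarrow> ennreal" and s \<alpha> :: real
  assumes [measurable]: "h \<in> borel_measurable borel"
  defines "C \<equiv> (\<integral>\<^sup>+\<theta>\<in>{0<..<pi}. ennreal (sin \<theta> powr (2 * \<alpha>)) \<partial>lborel)"
  shows "(\<integral>\<^sup>+t\<in>{0<..}. (\<integral>\<^sup>+\<theta>\<in>{0<..<pi}. h (sqrt (s\<^sup>2 + t\<^sup>2 + 2 * s * t * cos \<theta>))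
        * ennreal (sin \<theta> powr (2 * \<alpha>)) \<partial>lborel) * ennreal (t powr (2 * \<alpha> + 1)) \<partial>lborel)
    = C * (\<integral>\<^sup>+r\<in>{0<..}. h r * ennreal (r powr (2 * \<alpha> + 1)) \<partial>lborel)"
proof -
  define G where "G s = (\<integral>\<^sup>+t\<in>{0<..}. (\<integral>\<^sup>+\<theta>\<in>{0<..<pi}. h (sqrt (s\<^sup>2 + t\<^sup>2 + 2 * s * t * cos \<theta>))
        * ennreal (sin \<theta> powr (2 * \<alpha>)) \<partial>lborel) * ennreal (t powr (2 * \<alpha> + 1)) \<partial>lborel)" for s
  have cartesian: "G s = (\<integral>\<^sup>+v\<in>{0<..}. (\<integral>\<^sup>+u. h (sqrt ((s + u)\<^sup>2 + v\<^sup>2)) * ennreal (v powr (2 * \<alpha>)) \<partial>lborel) \<partial>lborel)" for s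
  proof -
    let ?F = "\<lambda>(u, v). h (sqrt ((s + u)\<^sup>2 + v\<^sup>2)) * ennreal (v powr (2 * \<alpha>))"
    have m: "?F \<in> borel_measurable borel"
      unfolding borel_prod[symmetric] by measurable
    have "(\<integral>\<^sup>+\<theta>\<in>{0<..<pi}. ?F (t * cos \<theta>, t * sin \<theta>) \<partial>lborel) * ennreal t
        = (\<integral>\<^sup>+\<theta>\<in>{0<..<pi}. h (sqrt (s\<^sup>2 + t\<^sup>2 + 2 * s * t * cos \<theta>))
            * ennreal (sin \<theta> powr (2 * \<alpha>)) \<partial>lborel) * ennreal (t powr (2 * \<alpha> + 1))" if "t > 0" for t
    proof -
      have "(s + t * cos \<theta>)\<^sup>2 + (t * sin \<theta>)\<^sup>2 = s\<^sup>2 + t\<^sup>2 + 2 * s * t * cos \<theta>" for \<theta>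
      proof -
        have "(s + t * cos \<theta>)\<^sup>2 + (t * sin \<theta>)\<^sup>2
            = s\<^sup>2 + t\<^sup>2 * ((sin \<theta>)\<^sup>2 + (cos \<theta>)\<^sup>2) + 2 * s * t * cos \<theta>"
          by (simp only: power2_eq_square ring_distribs) (simp add: algebra_simps)
        then show ?thesis by (simp only: sin_cos_squared_add mult_1_right)
      qed
      then have "(\<integral>\<^sup>+\<theta>\<in>{0<..<pi}. ?F (t * cos \<theta>, t * sin \<theta>) \<partial>lborel)
        = (\<integral>\<^sup>+\<theta>. h (sqrt (s\<^sup>2 + t\<^sup>2 + 2 * s * t * cos \<theta>))
            * ennreal (sin \<theta> powr (2 * \<alpha>)) * indicator {0<..<pi} \<theta> * ennreal (t powr (2 * \<alpha>)) \<partial>lborel)"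
        using that
        by (intro nn_integral_cong)
          (auto simp: powr_mult ennreal_mult' mult_ac sin_gt_zero less_imp_le split: split_indicator)
      also have "\<dots> = (\<integral>\<^sup>+\<theta>\<in>{0<..<pi}. h (sqrt (s\<^sup>2 + t\<^sup>2 + 2 * s * t * cos \<theta>))
            * ennreal (sin \<theta> powr (2 * \<alpha>)) \<partial>lborel) * ennreal (t powr (2 * \<alpha>))"
        by (rule nn_integral_multc) measurable
      finally show ?thesis
        using that by (simp add: powr_add ennreal_mult' mult.assoc)
    qed
    then have "G s = (\<integral>\<^sup>+t\<in>{0<..}. (\<integral>\<^sup>+\<theta>\<in>{0<..<pi}. ?F (t * cos \<theta>, t * sin \<theta>) \<partial>lborel) * ennreal t \<partial>lborel)"
      unfolding G_def by (intro nn_integral_cong) (auto split: split_indicator)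
    then show ?thesis
      using nn_integral_polar_half_plane[OF m] by simp
  qed
  have "G s = G 0"
    unfolding cartesian
  proof (rule nn_integral_cong)
    fix v :: real
    have "(\<integral>\<^sup>+u. h (sqrt ((s + u)\<^sup>2 + v\<^sup>2)) * ennreal (v powr (2 * \<alpha>)) \<partial>lborel)
      = (\<integral>\<^sup>+u. h (sqrt ((0 + u)\<^sup>2 + v\<^sup>2)) * ennreal (v powr (2 * \<alpha>)) \<partial>lborel)"
      by (subst (2) nn_integral_real_affine[where c = 1 and t = s]) auto
    then show "(\<integral>\<^sup>+u. h (sqrt ((s + u)\<^sup>2 + v\<^sup>2)) * ennreal (v powr (2 * \<alpha>)) \<partial>lborel) * indicator {0<..} v
      = (\<integral>\<^sup>+u. h (sqrt ((0 + u)\<^sup>2 + v\<^sup>2)) * ennreal (v powr (2 * \<alpha>)) \<partial>lborel) * indicator {0<..} v"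
      by simp
  qed
  also have "G 0 = (\<integral>\<^sup>+r. C * (h r * ennreal (r powr (2 * \<alpha> + 1)) * indicator {0<..} r) \<partial>lborel)"
    unfolding G_def
  proof (intro nn_integral_cong)
    fix r :: real
    have "(\<integral>\<^sup>+\<theta>\<in>{0<..<pi}. h r * ennreal (sin \<theta> powr (2 * \<alpha>)) \<partial>lborel) = h r * C"
      unfolding C_def mult.assoc by (rule nn_integral_cmult) measurable
    then show "(\<integral>\<^sup>+\<theta>\<in>{0<..<pi}. h (sqrt (0\<^sup>2 + r\<^sup>2 + 2 * 0 * r * cos \<theta>)) * ennreal (sin \<theta> powr (2 * \<alpha>)) \<partial>lborel)
        * ennreal (r powr (2 * \<alpha> + 1)) * indicator {0<..} r
      = C * (h r * ennreal (r powr (2 * \<alpha> + 1)) * indicator {0<..} r)"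
      by (auto simp: mult_ac split: split_indicator)
  qed
  also have "\<dots> = C * (\<integral>\<^sup>+r\<in>{0<..}. h r * ennreal (r powr (2 * \<alpha> + 1)) \<partial>lborel)"
    by (rule nn_integral_cmult) measurable
  finally show ?thesis
    by (simp add: G_def)
qed

section \<open>The Weinstein measure\<close>

lemma borel_measurable_fst [measurable]:
  "(fst :: 'a::second_countable_topology \<times> 'b::second_countable_topology \<Rightarrow> 'a) \<in> borel_measurable borel"
  unfolding borel_prod[symmetric] by measurable

lemma borel_measurable_snd [measurable]:
  "(snd :: 'a::second_countable_topology \<times> 'b::second_countable_topology \<Rightarrow> 'b) \<in> borel_measurable borel"
  unfolding borel_prod[symmetric] by measurable

lemma half_space_borel [measurable]: "(half_space :: ((real^'d) \<times> real) set) \<in> sets borel"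
  unfolding half_space_def by (intro borel_open open_Collect_less continuous_intros)

definition weinstein_density :: "real \<Rightarrow> (real^'d) \<times> real \<Rightarrow> real" where
  "weinstein_density \<alpha> x = snd x powr (2 * \<alpha> + 1)
    / ((2 * pi) ^ CARD('d) * 2 powr (2 * \<alpha>) * (Gamma (\<alpha> + 1))\<^sup>2)"

lemma weinstein_density_measurable [measurable]: "weinstein_density \<alpha> \<in> borel_measurable borel"
  unfolding weinstein_density_def[abs_def] by measurable

lemma weinstein_measure_density:
  "weinstein_measure \<alpha> = density (restrict_space lborel half_space) (\<lambda>x. ennreal (weinstein_density \<alpha> x))"
  by (simp add: weinstein_measure_def weinstein_density_def)

lemma space_weinstein [simp]: "space (weinstein_measure \<alpha>) = half_space"
  by (simp add: weinstein_measure_density space_restrict_space)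

lemma sets_weinstein [measurable_cong]:
  "sets (weinstein_measure \<alpha>) = sets (restrict_space borel half_space)"
  by (simp add: weinstein_measure_density sets_restrict_space)

lemma borel_measurable_weinstein:
  "f \<in> borel_measurable borel \<Longrightarrow> f \<in> borel_measurable (weinstein_measure \<alpha>)"
  by (simp add: measurable_restrict_space1 measurable_cong_sets[OF sets_weinstein refl])

lemma sigma_finite_weinstein: "sigma_finite_measure (weinstein_measure \<alpha>)"
proof -
  interpret L: sigma_finite_measure "restrict_space lborel (half_space :: ((real^'d) \<times> real) set)"
    by (rule sigma_finite_measure_restrict_space) (auto intro: sigma_finite_lborel)
  show ?thesis
    unfolding weinstein_measure_density
    by (subst L.sigma_finite_iff_density_finite) (auto intro!: measurable_restrict_space1)
qed

lemma nn_integral_weinstein: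
  fixes g :: "(real^'d) \<times> real \<Rightarrow> ennreal"
  assumes [measurable]: "g \<in> borel_measurable borel"
  shows "(\<integral>\<^sup>+x. g x \<partial>weinstein_measure \<alpha>)
    = (\<integral>\<^sup>+x. g x * ennreal (weinstein_density \<alpha> x) * indicator half_space x \<partial>lborel)"
  unfolding weinstein_measure_density
  by (subst nn_integral_density)
    (auto simp: nn_integral_restrict_space mult_ac intro!: measurable_restrict_space1)

lemma nn_integral_weinstein_iterated:
  fixes g :: "(real^'d) \<times> real \<Rightarrow> ennreal"
  assumes [measurable]: "g \<in> borel_measurable borel"
  shows "(\<integral>\<^sup>+x. g x \<partial>weinstein_measure \<alpha>)
    = ennreal (1 / ((2 * pi) ^ CARD('d) * 2 powr (2 * \<alpha>) * (Gamma (\<alpha> + 1))\<^sup>2))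
      * (\<integral>\<^sup>+z. (\<integral>\<^sup>+t\<in>{0<..}. g (z, t) * ennreal (t powr (2 * \<alpha> + 1)) \<partial>lborel) \<partial>lborel)"
    (is "_ = ennreal ?K * _")
proof -
  have K: "?K \<ge> 0" by simp
  have [measurable]: "(\<lambda>(z, t). g (z, t)) \<in> borel_measurable (borel \<Otimes>\<^sub>M borel)"
    by (simp add: borel_prod)
  have "(\<integral>\<^sup>+x. g x \<partial>weinstein_measure \<alpha>)
    = (\<integral>\<^sup>+x. ennreal ?K * (case x of (z, t) \<Rightarrow> g (z, t) * ennreal (t powr (2 * \<alpha> + 1)) * indicator {0<..} t) \<partial>lborel)"
    unfolding nn_integral_weinstein[OF assms] weinstein_density_def
    using K by (intro nn_integral_cong)
      (auto simp: half_space_def ennreal_mult'[symmetric] mult_ac divide_inverse split: split_indicator)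
  also have "\<dots> = ennreal ?K * (\<integral>\<^sup>+x. (case x of (z, t) \<Rightarrow> g (z, t) * ennreal (t powr (2 * \<alpha> + 1)) * indicator {0<..} t) \<partial>lborel)"
    unfolding lborel_prod[symmetric] by (intro nn_integral_cmult) measurable
  also have "(\<integral>\<^sup>+x. (case x of (z, t) \<Rightarrow> g (z, t) * ennreal (t powr (2 * \<alpha> + 1)) * indicator {0<..} t) \<partial>lborel)
    = (\<integral>\<^sup>+z. (\<integral>\<^sup>+t\<in>{0<..}. g (z, t) * ennreal (t powr (2 * \<alpha> + 1)) \<partial>lborel) \<partial>lborel)"
    unfolding lborel_prod[symmetric] by (subst lborel.nn_integral_fst[symmetric]) auto
  finally show ?thesis .
qed

text \<open>
  The exponent collects \<open>d + 1\<close> from Lebesgue measure and \<open>2 \<alpha> + 1\<close> from the density. It is exactly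
  what the normalization of \<^const>\<open>weinstein_dilation\<close> compensates.
\<close>

lemma nn_integral_weinstein_dilation:
  fixes g :: "(real^'d) \<times> real \<Rightarrow> ennreal"
  assumes [measurable]: "g \<in> borel_measurable borel" and a: "a > 0"
  shows "(\<integral>\<^sup>+y. g (y /\<^sub>R a) \<partial>weinstein_measure \<alpha>)
    = ennreal (a powr (2 * \<alpha> + real CARD('d) + 2)) * (\<integral>\<^sup>+y. g y \<partial>weinstein_measure \<alpha>)"
proof -
  let ?G = "\<lambda>y. g (y /\<^sub>R a) * ennreal (weinstein_density \<alpha> y) * indicator half_space y"
  have "(\<integral>\<^sup>+y. g (y /\<^sub>R a) \<partial>weinstein_measure \<alpha>) = (\<integral>\<^sup>+y. ?G y \<partial>lborel)"
    by (rule nn_integral_weinstein) measurable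
  also have "\<dots> = (\<integral>\<^sup>+y. ?G y \<partial>density (distr lborel borel (\<lambda>x :: (real^'d) \<times> real. 0 + a *\<^sub>R x))
      (\<lambda>_. \<bar>a\<bar> ^ DIM((real^'d) \<times> real)))"
    using a by (subst lborel_affine[of a 0]) auto
  also have "\<dots> = (\<integral>\<^sup>+y. ennreal (a ^ (CARD('d) + 1)) * ?G (a *\<^sub>R y) \<partial>lborel)"
    using a by (simp add: nn_integral_density nn_integral_distr)
  also have "\<dots> = (\<integral>\<^sup>+y. ennreal (a powr (2 * \<alpha> + real CARD('d) + 2))
      * (g y * ennreal (weinstein_density \<alpha> y) * indicator half_space y) \<partial>lborel)"
  proof (rule nn_integral_cong)
    fix y :: "(real^'d) \<times> real"
    show "ennreal (a ^ (CARD('d) + 1)) * ?G (a *\<^sub>R y) = ennreal (a powr (2 * \<alpha> + real CARD('d) + 2))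
      * (g y * ennreal (weinstein_density \<alpha> y) * indicator half_space y)"
    proof (cases "y \<in> half_space")
      case True
      then have "weinstein_density \<alpha> (a *\<^sub>R y) = a powr (2 * \<alpha> + 1) * weinstein_density \<alpha> y"
        using a by (simp add: weinstein_density_def half_space_def powr_mult)
      then have d: "ennreal (weinstein_density \<alpha> (a *\<^sub>R y))
          = ennreal (a powr (2 * \<alpha> + 1)) * ennreal (weinstein_density \<alpha> y)"
        by (simp add: ennreal_mult')
      have "a ^ (CARD('d) + 1) * a powr (2 * \<alpha> + 1) = a powr (real (CARD('d) + 1) + (2 * \<alpha> + 1))"
        using a by (simp only: powr_add powr_realpow)
      also have "real (CARD('d) + 1) + (2 * \<alpha> + 1) = 2 * \<alpha> + real CARD('d) + 2"
        by simp
      finally have e: "ennreal (a ^ (CARD('d) + 1)) * ennreal (a powr (2 * \<alpha> + 1))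
          = ennreal (a powr (2 * \<alpha> + real CARD('d) + 2))"
        by (metis ennreal_mult'' powr_ge_zero)
      have "a *\<^sub>R y \<in> half_space" "a *\<^sub>R y /\<^sub>R a = y"
        using True a by (simp_all add: half_space_def)
      then have "ennreal (a ^ (CARD('d) + 1)) * ?G (a *\<^sub>R y)
          = (ennreal (a ^ (CARD('d) + 1)) * ennreal (a powr (2 * \<alpha> + 1))) * (g y * ennreal (weinstein_density \<alpha> y))"
        by (simp only: d indicator_simps mult_1_right) (simp only: mult_ac)
      then show ?thesis
        using True by (simp only: e indicator_simps mult_1_right)
    next
      case False
      then have "a *\<^sub>R y \<notin> half_space"
        using a by (simp add: half_space_def zero_less_mult_iff)
      with False show ?thesis by simp
    qed
  qed
  also have "\<dots> = ennreal (a powr (2 * \<alpha> + real CARD('d) + 2)) * (\<integral>\<^sup>+y. g y \<partial>weinstein_measure \<alpha>)"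
    unfolding nn_integral_weinstein[OF assms(1)] by (intro nn_integral_cmult) measurable
  finally show ?thesis .
qed

section \<open>Generalized translation\<close>

definition weinstein_point :: "(real^'d) \<times> real \<Rightarrow> (real^'d) \<times> real \<Rightarrow> real \<Rightarrow> (real^'d) \<times> real" where
  "weinstein_point x y \<theta> =
    (fst x + fst y, sqrt ((snd x)\<^sup>2 + (snd y)\<^sup>2 + 2 * snd x * snd y * cos \<theta>))"

lemma weinstein_point_measurable [measurable (raw)]:
  assumes [measurable]: "f \<in> borel_measurable M" "g \<in> borel_measurable M" "h \<in> borel_measurable M"
  shows "(\<lambda>z. weinstein_point (f z) (g z) (h z)) \<in> borel_measurable M"
  unfolding weinstein_point_def by measurable

text \<open>
  A function on the half space is determined only there, so its translation is meaningful because the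
  averaging never leaves the half space. The angle \<open>pi\<close>, at which the last coordinate is
  \<open>|x\<^bsub>d+1\<^esub> - y\<^bsub>d+1\<^esub>|\<close>, has to be excluded.
\<close>

lemma weinstein_point_half_space:
  assumes "x \<in> half_space" "y \<in> half_space" "\<theta> \<in> {0<..<pi}"
  shows "weinstein_point x y \<theta> \<in> half_space"
proof -
  have s: "snd x > 0" "snd y > 0"
    using assms by (auto simp: half_space_def)
  have "cos pi < cos \<theta>"
    using assms(3) by (intro cos_monotone_0_pi) auto
  then have "0 \<le> (snd x - snd y)\<^sup>2" "0 < 2 * snd x * snd y * (1 + cos \<theta>)"
    using s by auto
  then have "0 < (snd x - snd y)\<^sup>2 + 2 * snd x * snd y * (1 + cos \<theta>)"
    by linarith
  also have "\<dots> = (snd x)\<^sup>2 + (snd y)\<^sup>2 + 2 * snd x * snd y * cos \<theta>"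
    by (simp add: power2_eq_square algebra_simps)
  finally show ?thesis
    by (simp add: half_space_def weinstein_point_def)
qed

definition translation_const :: "real \<Rightarrow> real" where
  "translation_const \<alpha> = Gamma (\<alpha> + 1) / (sqrt pi * Gamma (\<alpha> + 1/2))"

lemma translation_const_pos: "\<alpha> > - 1/2 \<Longrightarrow> translation_const \<alpha> > 0"
  by (simp add: translation_const_def)

lemma translation_const_normalizes:
  assumes "\<alpha> > - 1/2"
  shows "ennreal (translation_const \<alpha>) * (\<integral>\<^sup>+\<theta>\<in>{0<..<pi}. ennreal (sin \<theta> powr (2 * \<alpha>)) \<partial>lborel) = 1"
proof -
  have "Gamma (\<alpha> + 1) > 0" "Gamma (\<alpha> + 1/2) > 0"
    using assms by (auto intro!: Gamma_real_pos)
  then show ?thesis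
    unfolding nn_integral_sin_powr[OF assms]
    by (simp add: translation_const_def ennreal_mult'[symmetric])
qed

text \<open>
  Stated for extended nonnegative functions, so that the average always exists and Tonelli's theorem
  applies. It dominates the norm of the translation of a complex function.
\<close>

definition nn_translation ::
    "real \<Rightarrow> (real^'d) \<times> real \<Rightarrow> ((real^'d) \<times> real \<Rightarrow> ennreal) \<Rightarrow> (real^'d) \<times> real \<Rightarrow> ennreal" where
  "nn_translation \<alpha> x g y = ennreal (translation_const \<alpha>) *
     (\<integral>\<^sup>+\<theta>\<in>{0<..<pi}. g (weinstein_point x y \<theta>) * ennreal (sin \<theta> powr (2 * \<alpha>)) \<partial>lborel)"

lemma nn_translation_measurable [measurable]:
  assumes [measurable]: "g \<in> borel_measurable borel"
  shows "nn_translation \<alpha> x g \<in> borel_measurable borel"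
  unfolding nn_translation_def by measurable

text \<open>
  The last coordinate is treated by \<open>nn_integral_law_of_cosines\<close>, the others by the translation
  invariance of Lebesgue measure.
\<close>

lemma nn_integral_nn_translation:
  fixes g :: "(real^'d) \<times> real \<Rightarrow> ennreal"
  assumes \<alpha>: "\<alpha> > - 1/2" and [measurable]: "g \<in> borel_measurable borel"
  shows "(\<integral>\<^sup>+y. nn_translation \<alpha> x g y \<partial>weinstein_measure \<alpha>) = (\<integral>\<^sup>+y. g y \<partial>weinstein_measure \<alpha>)"
proof -
  define J where "J z = (\<integral>\<^sup>+t\<in>{0<..}. g (z, t) * ennreal (t powr (2 * \<alpha> + 1)) \<partial>lborel)" for z
  have [measurable]: "(\<lambda>(z, t). g (z, t)) \<in> borel_measurable (borel \<Otimes>\<^sub>M borel)"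
    by (simp add: borel_prod)
  have J [measurable]: "J \<in> borel_measurable borel"
    unfolding J_def by measurable
  have inner: "(\<integral>\<^sup>+t\<in>{0<..}. nn_translation \<alpha> x g (z, t) * ennreal (t powr (2 * \<alpha> + 1)) \<partial>lborel)
    = J (fst x + z)" for z
  proof -
    let ?I = "\<lambda>t. (\<integral>\<^sup>+\<theta>\<in>{0<..<pi}. g (fst x + z, sqrt ((snd x)\<^sup>2 + t\<^sup>2 + 2 * snd x * t * cos \<theta>))
        * ennreal (sin \<theta> powr (2 * \<alpha>)) \<partial>lborel)"
    have "(\<integral>\<^sup>+t\<in>{0<..}. nn_translation \<alpha> x g (z, t) * ennreal (t powr (2 * \<alpha> + 1)) \<partial>lborel)
      = (\<integral>\<^sup>+t. ennreal (translation_const \<alpha>) * (?I t * ennreal (t powr (2 * \<alpha> + 1)) * indicator {0<..} t) \<partial>lborel)"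
      by (simp add: nn_translation_def weinstein_point_def mult.assoc)
    also have "\<dots> = ennreal (translation_const \<alpha>) * (\<integral>\<^sup>+t\<in>{0<..}. ?I t * ennreal (t powr (2 * \<alpha> + 1)) \<partial>lborel)"
      by (rule nn_integral_cmult) measurable
    also have "(\<integral>\<^sup>+t\<in>{0<..}. ?I t * ennreal (t powr (2 * \<alpha> + 1)) \<partial>lborel)
      = (\<integral>\<^sup>+\<theta>\<in>{0<..<pi}. ennreal (sin \<theta> powr (2 * \<alpha>)) \<partial>lborel) * J (fst x + z)"
      unfolding J_def by (rule nn_integral_law_of_cosines) measurable
    finally show ?thesis
      by (simp add: mult.assoc[symmetric] translation_const_normalizes[OF \<alpha>])
  qed
  have "(\<integral>\<^sup>+z. J (fst x + z) \<partial>lborel) = (\<integral>\<^sup>+z. J z \<partial>distr lborel borel ((+) (fst x)))"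
    by (rule nn_integral_distr[symmetric]) auto
  also have "\<dots> = (\<integral>\<^sup>+z. J z \<partial>lborel)"
    by (simp only: lborel_distr_plus)
  finally show ?thesis
    by (simp add: nn_integral_weinstein_iterated inner J_def)
qed

text \<open>
  The translation is an average with respect to a probability measure in \<open>\<theta>\<close>, so it is controlled by
  any bound that holds for almost every angle.
\<close>

lemma nn_translation_le_const:
  assumes \<alpha>: "\<alpha> > - 1/2"
    and "AE \<theta> in lborel. \<theta> \<in> {0<..<pi} \<longrightarrow> g (weinstein_point x y \<theta>) \<le> K"
  shows "nn_translation \<alpha> x g y \<le> K"
proof -
  have "(\<integral>\<^sup>+\<theta>\<in>{0<..<pi}. g (weinstein_point x y \<theta>) * ennreal (sin \<theta> powr (2 * \<alpha>)) \<partial>lborel)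
    \<le> (\<integral>\<^sup>+\<theta>. K * (ennreal (sin \<theta> powr (2 * \<alpha>)) * indicator {0<..<pi} \<theta>) \<partial>lborel)"
    using assms(2)
    by (intro nn_integral_mono_AE, elim AE_mp)
      (auto intro!: AE_I2 mult_right_mono split: split_indicator)
  also have "\<dots> = K * (\<integral>\<^sup>+\<theta>\<in>{0<..<pi}. ennreal (sin \<theta> powr (2 * \<alpha>)) \<partial>lborel)"
    by (rule nn_integral_cmult) measurable
  finally have "nn_translation \<alpha> x g y
      \<le> ennreal (translation_const \<alpha>) * (K * (\<integral>\<^sup>+\<theta>\<in>{0<..<pi}. ennreal (sin \<theta> powr (2 * \<alpha>)) \<partial>lborel))"
    unfolding nn_translation_def by (intro mult_left_mono) auto
  also have "\<dots> = K"
    using translation_const_normalizes[OF \<alpha>] by (metis mult.left_commute mult.right_neutral)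
  finally show ?thesis .
qed

lemma ennreal_norm_integral_le:
  fixes f :: "'a \<Rightarrow> 'b::{banach, second_countable_topology}"
  shows "ennreal (norm (\<integral>x. f x \<partial>M)) \<le> (\<integral>\<^sup>+x. ennreal (norm (f x)) \<partial>M)"
  by (cases "integrable M f") (auto simp: integral_norm_bound_ennreal not_integrable_integral_eq)

lemma weinstein_translation_eq:
  "weinstein_translation \<alpha> x \<phi> y = of_real (translation_const \<alpha>) *
    (\<integral>\<theta>. indicator {0<..<pi} \<theta> *\<^sub>R (\<phi> (weinstein_point x y \<theta>) * of_real (sin \<theta> powr (2 * \<alpha>))) \<partial>lborel)"
  unfolding weinstein_translation_def translation_const_def weinstein_point_def
  by (simp add: interval_lebesgue_integral_def set_lebesgue_integral_def zero_ereal_def)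

lemma norm_weinstein_translation_le:
  assumes "\<alpha> > - 1/2"
  shows "ennreal (norm (weinstein_translation \<alpha> x \<phi> y)) \<le> nn_translation \<alpha> x (\<lambda>z. ennreal (norm (\<phi> z))) y"
proof -
  let ?f = "\<lambda>\<theta>. indicator {0<..<pi} \<theta> *\<^sub>R (\<phi> (weinstein_point x y \<theta>) * of_real (sin \<theta> powr (2 * \<alpha>)))"
  have "(\<integral>\<^sup>+\<theta>. ennreal (norm (?f \<theta>)) \<partial>lborel)
    = (\<integral>\<^sup>+\<theta>\<in>{0<..<pi}. ennreal (norm (\<phi> (weinstein_point x y \<theta>))) * ennreal (sin \<theta> powr (2 * \<alpha>)) \<partial>lborel)"
    by (intro nn_integral_cong) (auto simp: norm_mult ennreal_mult' split: split_indicator)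
  then have "ennreal (norm (\<integral>\<theta>. ?f \<theta> \<partial>lborel))
    \<le> (\<integral>\<^sup>+\<theta>\<in>{0<..<pi}. ennreal (norm (\<phi> (weinstein_point x y \<theta>))) * ennreal (sin \<theta> powr (2 * \<alpha>)) \<partial>lborel)"
    using ennreal_norm_integral_le[of lborel ?f] by simp
  then show ?thesis
    unfolding weinstein_translation_eq nn_translation_def
    using translation_const_pos[OF assms]
    by (auto simp: norm_mult ennreal_mult' intro!: mult_left_mono)
qed

section \<open>Bounds for the wavelets\<close>

text \<open>
  Windows are measurable only on the half space, whereas the measurability of the wavelets jointly in
  \<open>a\<close>, \<open>x\<close>, \<open>y\<close> is most easily seen for Borel functions on the whole space.
\<close>

definition zero_extension :: "((real^'d) \<times> real \<Rightarrow> complex) \<Rightarrow> (real^'d) \<times> real \<Rightarrow> complex" where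
  "zero_extension \<phi> x = indicator half_space x *\<^sub>R \<phi> x"

lemma zero_extension_measurable:
  assumes "\<phi> \<in> borel_measurable (weinstein_measure \<alpha>)"
  shows "zero_extension \<phi> \<in> borel_measurable borel"
proof -
  have "\<phi> \<in> borel_measurable (restrict_space borel half_space)"
    using assms by (simp add: measurable_cong_sets[OF sets_weinstein refl])
  then show ?thesis
    by (simp add: borel_measurable_restrict_space_iff zero_extension_def[abs_def])
qed

lemma weinstein_wavelet_zero_extension:
  assumes "a > 0" "x \<in> half_space" "y \<in> half_space"
  shows "weinstein_wavelet \<alpha> (zero_extension \<phi>) a x y = weinstein_wavelet \<alpha> \<phi> a x y"
proof -
  have "weinstein_dilation \<alpha> a (zero_extension \<phi>) z = weinstein_dilation \<alpha> a \<phi> z"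
    if "z \<in> half_space" for z
    using that assms(1) by (simp add: weinstein_dilation_def zero_extension_def half_space_def)
  then have "weinstein_translation \<alpha> x (weinstein_dilation \<alpha> a (zero_extension \<phi>)) y
    = weinstein_translation \<alpha> x (weinstein_dilation \<alpha> a \<phi>) y"
    unfolding weinstein_translation_eq
    using weinstein_point_half_space[OF assms(2,3)]
    by (intro arg_cong2[where f = "(*)"] refl Bochner_Integration.integral_cong)
      (auto split: split_indicator)
  then show ?thesis
    by (simp add: weinstein_wavelet_def)
qed

lemma weinstein_wavelet_measurable [measurable (raw)]:
  assumes [measurable]: "\<phi> \<in> borel_measurable borel"
    "A \<in> borel_measurable M" "X \<in> borel_measurable M" "Y \<in> borel_measurable M"
  shows "(\<lambda>z. weinstein_wavelet \<alpha> \<phi> (A z) (X z) (Y z)) \<in> borel_measurable M"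
  unfolding weinstein_wavelet_def weinstein_translation_eq weinstein_dilation_def by measurable

lemma norm_weinstein_dilation:
  fixes \<phi> :: "(real^'d) \<times> real \<Rightarrow> complex"
  shows "ennreal (norm (weinstein_dilation \<alpha> a \<phi> z))
    = ennreal (a powr (- (2 * \<alpha> + real CARD('d) + 2))) * ennreal (norm (\<phi> (z /\<^sub>R a)))"
  by (simp add: weinstein_dilation_def norm_mult ennreal_mult')

lemma norm_weinstein_wavelet_le:
  fixes \<phi> :: "(real^'d) \<times> real \<Rightarrow> complex"
  assumes "\<alpha> > - 1/2" "a > 0" "x \<in> half_space" "y \<in> half_space"
  shows "ennreal (norm (weinstein_wavelet \<alpha> \<phi> a x y))
    \<le> ennreal (a powr (\<alpha> + 1 + real CARD('d) / 2))
      * nn_translation \<alpha> x (\<lambda>z. ennreal (norm (weinstein_dilation \<alpha> a (zero_extension \<phi>) z))) y"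
proof -
  have "ennreal (norm (weinstein_wavelet \<alpha> \<phi> a x y)) = ennreal (norm (weinstein_wavelet \<alpha> (zero_extension \<phi>) a x y))"
    using assms by (simp add: weinstein_wavelet_zero_extension)
  also have "\<dots> = ennreal (a powr (\<alpha> + 1 + real CARD('d) / 2))
      * ennreal (norm (weinstein_translation \<alpha> x (weinstein_dilation \<alpha> a (zero_extension \<phi>)) y))"
    by (simp add: weinstein_wavelet_def norm_mult ennreal_mult')
  also have "\<dots> \<le> ennreal (a powr (\<alpha> + 1 + real CARD('d) / 2))
      * nn_translation \<alpha> x (\<lambda>z. ennreal (norm (weinstein_dilation \<alpha> a (zero_extension \<phi>) z))) y"
    by (intro mult_left_mono norm_weinstein_translation_le assms) simp
  finally show ?thesis .
qed

text \<open>
  The wavelet is dominated by the translation of the absolute value of the dilated window. This translation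
  and the normalized dilation preserve the integral, so only the prefactor of the wavelet remains.
\<close>

lemma nn_integral_norm_weinstein_wavelet_le:
  fixes \<psi> :: "(real^'d) \<times> real \<Rightarrow> complex"
  assumes \<alpha>: "\<alpha> > - 1/2" and \<psi>: "\<psi> \<in> borel_measurable (weinstein_measure \<alpha>)"
    and a: "a > 0" and x: "x \<in> half_space"
  shows "(\<integral>\<^sup>+y. ennreal (norm (weinstein_wavelet \<alpha> \<psi> a x y)) \<partial>weinstein_measure \<alpha>)
    \<le> ennreal (a powr (\<alpha> + 1 + real CARD('d) / 2)) * (\<integral>\<^sup>+y. ennreal (norm (\<psi> y)) \<partial>weinstein_measure \<alpha>)"
proof -
  let ?e = "ennreal (a powr (\<alpha> + 1 + real CARD('d) / 2))"
  let ?b = "2 * \<alpha> + real CARD('d) + 2"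
  let ?g = "\<lambda>z. ennreal (norm (weinstein_dilation \<alpha> a (zero_extension \<psi>) z))"
  have ext [measurable]: "zero_extension \<psi> \<in> borel_measurable borel"
    using \<psi> by (rule zero_extension_measurable)
  have g [measurable]: "?g \<in> borel_measurable borel"
    unfolding norm_weinstein_dilation by measurable
  have "(\<integral>\<^sup>+y. ennreal (norm (weinstein_wavelet \<alpha> \<psi> a x y)) \<partial>weinstein_measure \<alpha>)
    \<le> (\<integral>\<^sup>+y. ?e * nn_translation \<alpha> x ?g y \<partial>weinstein_measure \<alpha>)"
    using norm_weinstein_wavelet_le[OF \<alpha> a x] by (intro nn_integral_mono) simp
  also have "\<dots> = ?e * (\<integral>\<^sup>+y. nn_translation \<alpha> x ?g y \<partial>weinstein_measure \<alpha>)"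
    by (intro nn_integral_cmult borel_measurable_weinstein nn_translation_measurable g)
  also have "(\<integral>\<^sup>+y. nn_translation \<alpha> x ?g y \<partial>weinstein_measure \<alpha>) = (\<integral>\<^sup>+y. ?g y \<partial>weinstein_measure \<alpha>)"
    using \<alpha> g by (rule nn_integral_nn_translation)
  also have "\<dots> = ennreal (a powr (- ?b)) * (\<integral>\<^sup>+y. ennreal (norm (zero_extension \<psi> (y /\<^sub>R a))) \<partial>weinstein_measure \<alpha>)"
    unfolding norm_weinstein_dilation
    by (intro nn_integral_cmult borel_measurable_weinstein) measurable
  also have "(\<integral>\<^sup>+y. ennreal (norm (zero_extension \<psi> (y /\<^sub>R a))) \<partial>weinstein_measure \<alpha>)
    = ennreal (a powr ?b) * (\<integral>\<^sup>+y. ennreal (norm (zero_extension \<psi> y)) \<partial>weinstein_measure \<alpha>)"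
    using a by (intro nn_integral_weinstein_dilation) measurable
  also have "(\<integral>\<^sup>+y. ennreal (norm (zero_extension \<psi> y)) \<partial>weinstein_measure \<alpha>)
    = (\<integral>\<^sup>+y. ennreal (norm (\<psi> y)) \<partial>weinstein_measure \<alpha>)"
    by (intro nn_integral_cong) (simp add: zero_extension_def)
  also have "ennreal (a powr (- ?b)) * (ennreal (a powr ?b) * (\<integral>\<^sup>+y. ennreal (norm (\<psi> y)) \<partial>weinstein_measure \<alpha>))
    = (\<integral>\<^sup>+y. ennreal (norm (\<psi> y)) \<partial>weinstein_measure \<alpha>)"
  proof -
    have "ennreal (a powr (- ?b)) * ennreal (a powr ?b) = 1"
      using a by (simp add: ennreal_mult'[symmetric] powr_add[symmetric])
    then show ?thesis
      by (simp add: mult.assoc[symmetric])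
  qed
  finally show ?thesis .
qed

text \<open>
  The set where the dilated window exceeds its bound is null. By the invariance of the integral, so is
  the set of those \<open>y\<close> for which translation meets it with positive probability. The exponent
  arises as \<open>(\<alpha> + 1 + d/2) - (2 \<alpha> + d + 2)\<close>.
\<close>

lemma AE_norm_weinstein_wavelet_le:
  fixes \<phi> :: "(real^'d) \<times> real \<Rightarrow> complex"
  assumes \<alpha>: "\<alpha> > - 1/2" and \<phi>: "\<phi> \<in> borel_measurable (weinstein_measure \<alpha>)"
    and bound: "AE z in weinstein_measure \<alpha>. norm (\<phi> z) \<le> K"
    and a: "a > 0" and x: "x \<in> half_space"
  shows "AE y in weinstein_measure \<alpha>.
    norm (weinstein_wavelet \<alpha> \<phi> a x y) \<le> a powr (- (\<alpha> + 1 + real CARD('d) / 2)) * K"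
proof (cases "K \<ge> 0")
  case False
  show ?thesis
    using bound by eventually_elim (metis False norm_ge_zero order_trans)
next
  case K: True
  let ?e = "\<alpha> + 1 + real CARD('d) / 2"
  let ?b = "2 * \<alpha> + real CARD('d) + 2"
  have ext [measurable]: "zero_extension \<phi> \<in> borel_measurable borel"
    using \<phi> by (rule zero_extension_measurable)
  define N where "N = {z. K < norm (zero_extension \<phi> z)}"
  have [measurable]: "N \<in> sets borel"
    unfolding N_def by measurable
  define g :: "(real^'d) \<times> real \<Rightarrow> ennreal" where "g z = indicator N (z /\<^sub>R a)" for z
  have g [measurable]: "g \<in> borel_measurable borel"
    unfolding g_def by measurable
  have "(\<integral>\<^sup>+z. indicator N z \<partial>weinstein_measure \<alpha>) = (\<integral>\<^sup>+(z :: (real^'d) \<times> real). 0 \<partial>weinstein_measure \<alpha>)"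
    using bound AE_space
    by (intro nn_integral_cong_AE, elim AE_mp[OF AE_conjI])
      (auto intro!: AE_I2 simp: N_def zero_extension_def split: split_indicator)
  then have "(\<integral>\<^sup>+y. g y \<partial>weinstein_measure \<alpha>) = 0"
    unfolding g_def using a by (subst nn_integral_weinstein_dilation) auto
  then have "(\<integral>\<^sup>+y. nn_translation \<alpha> x g y \<partial>weinstein_measure \<alpha>) = 0"
    by (simp add: nn_integral_nn_translation[OF \<alpha> g])
  then have "AE y in weinstein_measure \<alpha>. nn_translation \<alpha> x g y = 0"
    by (subst (asm) nn_integral_0_iff_AE) (auto intro!: borel_measurable_weinstein)
  then show ?thesis
    using AE_space
  proof eventually_elim
    case (elim y)
    then have y: "y \<in> half_space" by simp
    have "(\<integral>\<^sup>+\<theta>\<in>{0<..<pi}. g (weinstein_point x y \<theta>) * ennreal (sin \<theta> powr (2 * \<alpha>)) \<partial>lborel) = 0"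
      using elim(1) translation_const_pos[OF \<alpha>] by (simp add: nn_translation_def)
    then have "AE \<theta> in lborel. g (weinstein_point x y \<theta>) * ennreal (sin \<theta> powr (2 * \<alpha>)) * indicator {0<..<pi} \<theta> = 0"
      by (subst (asm) nn_integral_0_iff_AE) auto
    then have "AE \<theta> in lborel. \<theta> \<in> {0<..<pi} \<longrightarrow>
        ennreal (norm (weinstein_dilation \<alpha> a (zero_extension \<phi>) (weinstein_point x y \<theta>)))
          \<le> ennreal (a powr (- ?b) * K)"
    proof (rule AE_mp, intro AE_I2 impI)
      fix \<theta> :: real
      assume z: "g (weinstein_point x y \<theta>) * ennreal (sin \<theta> powr (2 * \<alpha>)) * indicator {0<..<pi} \<theta> = 0"
        and \<theta>: "\<theta> \<in> {0<..<pi}"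
      have "sin \<theta> > 0"
        using \<theta> by (intro sin_gt_zero) auto
      with z \<theta> have "g (weinstein_point x y \<theta>) = 0"
        by simp
      then have "norm (zero_extension \<phi> (weinstein_point x y \<theta> /\<^sub>R a)) \<le> K"
        by (simp add: g_def N_def indicator_eq_0_iff)
      then show "ennreal (norm (weinstein_dilation \<alpha> a (zero_extension \<phi>) (weinstein_point x y \<theta>)))
          \<le> ennreal (a powr (- ?b) * K)"
        using K by (simp add: norm_weinstein_dilation ennreal_mult'[symmetric] mult_left_mono)
    qed
    then have "nn_translation \<alpha> x (\<lambda>z. ennreal (norm (weinstein_dilation \<alpha> a (zero_extension \<phi>) z))) y
      \<le> ennreal (a powr (- ?b) * K)"
      by (rule nn_translation_le_const[OF \<alpha>])
    then have "ennreal (norm (weinstein_wavelet \<alpha> \<phi> a x y)) \<le> ennreal (a powr ?e) * ennreal (a powr (- ?b) * K)"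
      by (intro order_trans[OF norm_weinstein_wavelet_le[OF \<alpha> a x y]] mult_left_mono) auto
    also have "\<dots> = ennreal (a powr ?e * a powr (- ?b) * K)"
      by (simp add: ennreal_mult'[symmetric] mult.assoc)
    also have "a powr ?e * a powr (- ?b) = a powr (?e + - ?b)"
      by (rule powr_add[symmetric])
    also have "?e + - ?b = - ?e"
      by simp
    finally show ?case
      using K by (simp add: ennreal_le_iff)
  qed
qed

section \<open>Measurability on the phase space\<close>

lemma space_weinstein_phase: "space (weinstein_phase_measure \<alpha>) = {0<..} \<times> half_space"
  by (simp add: weinstein_phase_measure_def space_pair_measure space_restrict_space)

lemma sets_weinstein_phase [measurable_cong]:
  "sets (weinstein_phase_measure \<alpha>)
    = sets (restrict_space borel {0<..} \<Otimes>\<^sub>M restrict_space borel half_space)"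
  unfolding weinstein_phase_measure_def sets_density
  by (intro sets_pair_measure_cong sets_weinstein) (simp add: sets_restrict_space)

lemma sigma_finite_weinstein_phase:
  "sigma_finite_measure (weinstein_phase_measure \<alpha> :: (real \<times> ((real^'d) \<times> real)) measure)"
proof -
  let ?L = "restrict_space lborel {0<..} :: real measure"
  let ?\<mu> = "weinstein_measure \<alpha> :: ((real^'d) \<times> real) measure"
  interpret L: sigma_finite_measure ?L
    by (rule sigma_finite_measure_restrict_space) (auto intro: sigma_finite_lborel)
  interpret \<mu>: sigma_finite_measure ?\<mu>
    by (rule sigma_finite_weinstein)
  interpret L\<mu>: pair_sigma_finite ?L ?\<mu> ..
  have fst_meas: "fst \<in> borel_measurable (?L \<Otimes>\<^sub>M ?\<mu>)"
    by (rule measurable_compose[OF measurable_fst, of "\<lambda>x. x"])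
      (simp add: measurable_restrict_space1)
  then have "(\<lambda>(a, x). ennreal (1 / a powr (2 * \<alpha> + real CARD('d) + 3))) \<in> borel_measurable (?L \<Otimes>\<^sub>M ?\<mu>)"
    unfolding case_prod_beta' by measurable
  then show ?thesis
    unfolding weinstein_phase_measure_def
    by (subst L\<mu>.P.sigma_finite_iff_density_finite) auto
qed

lemma weinstein_wavelet_phase_measurable:
  fixes \<phi> :: "(real^'d) \<times> real \<Rightarrow> complex"
  assumes "\<phi> \<in> borel_measurable (weinstein_measure \<alpha>)"
  shows "(\<lambda>(q, y). weinstein_wavelet \<alpha> \<phi> (fst q) (snd q) y)
    \<in> borel_measurable (weinstein_phase_measure \<alpha> \<Otimes>\<^sub>M weinstein_measure \<alpha>)"
proof -
  let ?M = "weinstein_phase_measure \<alpha> \<Otimes>\<^sub>M weinstein_measure \<alpha> :: ((real \<times> (real^'d) \<times> real) \<times> (real^'d) \<times> real) measure"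
  have ext [measurable]: "zero_extension \<phi> \<in> borel_measurable borel"
    using assms by (rule zero_extension_measurable)
  have q: "fst \<in> ?M \<rightarrow>\<^sub>M restrict_space borel {0<..} \<Otimes>\<^sub>M restrict_space borel half_space"
    using measurable_fst by (simp add: measurable_cong_sets[OF refl sets_weinstein_phase[symmetric]])
  have [measurable]: "(\<lambda>p. fst (fst p)) \<in> borel_measurable ?M"
    by (rule measurable_compose[OF measurable_compose[OF q measurable_fst], of "\<lambda>x. x"])
      (simp add: measurable_restrict_space1)
  have [measurable]: "(\<lambda>p. snd (fst p)) \<in> borel_measurable ?M"
    by (rule measurable_compose[OF measurable_compose[OF q measurable_snd], of "\<lambda>x. x"])
      (simp add: measurable_restrict_space1)
  have [measurable]: "snd \<in> borel_measurable ?M"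
    by (rule measurable_compose[OF measurable_snd, of "\<lambda>x. x"])
      (simp add: borel_measurable_weinstein)
  have "(\<lambda>p. weinstein_wavelet \<alpha> (zero_extension \<phi>) (fst (fst p)) (snd (fst p)) (snd p)) \<in> borel_measurable ?M"
    by measurable
  also have "?this \<longleftrightarrow> ?thesis"
    by (intro measurable_cong)
      (auto simp: space_pair_measure space_weinstein_phase weinstein_wavelet_zero_extension)
  finally show ?thesis .
qed

section \<open>Localization with general kernels on \<open>L\<^sup>1\<close>\<close>

lemma Lp_space_1: "Lp_space 1 M = {f. integrable M f}"
  by (auto simp: Lp_space_def integrable_norm_iff)

lemma Lp_norm_1: "Lp_norm 1 M f = (\<integral>x. norm (f x) \<partial>M)"
  by (simp add: Lp_norm_def)

lemma Lp_infinity_AE_bound: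
  assumes "f \<in> Lp_space \<infinity> M"
  shows "AE x in M. norm (f x) \<le> Lp_norm \<infinity> M f"
proof -
  let ?s = "esssup M (\<lambda>x. ennreal (norm (f x)))"
  have [measurable]: "f \<in> borel_measurable M" and fin: "?s < \<infinity>"
    using assms by (auto simp: Lp_space_def)
  have "AE x in M. ennreal (norm (f x)) \<le> ?s"
    by (rule esssup_AE)
  then show ?thesis
  proof eventually_elim
    case (elim x)
    then show ?case
      using fin enn2real_mono[of "ennreal (norm (f x))" ?s] by (simp add: Lp_norm_def)
  qed
qed

lemma cnj_measurable [measurable]: "cnj \<in> borel_measurable borel"
  by (intro borel_measurable_continuous_onI continuous_intros)

text \<open>
  The mechanism of the estimate in isolation. The kernel \<open>U q\<close> is bounded by \<open>u q\<close> almost everywhere and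
  \<open>V q\<close> has \<open>L\<^sup>1\<close> norm at most \<open>v q\<close>. Neither bound has to be uniform in \<open>q\<close>, as the estimate
  sees only their product.
\<close>

locale two_kernel_operator =
  M: sigma_finite_measure M + Q: sigma_finite_measure Q
  for M :: "'a measure" and Q :: "'q measure" +
  fixes \<sigma> :: "'q \<Rightarrow> complex" and U V :: "'q \<Rightarrow> 'a \<Rightarrow> complex"
    and u v :: "'q \<Rightarrow> real" and K :: real
  assumes symbol: "integrable Q \<sigma>"
    and U_measurable: "(\<lambda>(q, y). U q y) \<in> borel_measurable (Q \<Otimes>\<^sub>M M)"
    and V_measurable: "(\<lambda>(q, y). V q y) \<in> borel_measurable (Q \<Otimes>\<^sub>M M)"
    and U_bound: "q \<in> space Q \<Longrightarrow> AE y in M. norm (U q y) \<le> u q"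
    and V_bound: "q \<in> space Q \<Longrightarrow> (\<integral>\<^sup>+y. ennreal (norm (V q y)) \<partial>M) \<le> ennreal (v q)"
    and bound_nonneg: "q \<in> space Q \<Longrightarrow> 0 \<le> u q" "q \<in> space Q \<Longrightarrow> 0 \<le> v q"
    and bound_product: "q \<in> space Q \<Longrightarrow> u q * v q = K"
    and bound_product_nonneg: "0 \<le> K"
begin

sublocale MQ: pair_sigma_finite M Q ..

definition coefficient :: "('a \<Rightarrow> complex) \<Rightarrow> 'q \<Rightarrow> complex" where
  "coefficient f q = (\<integral>y. f y * cnj (U q y) \<partial>M)"

definition synthesis :: "('a \<Rightarrow> complex) \<Rightarrow> 'a \<Rightarrow> complex" where
  "synthesis f y = (\<integral>q. \<sigma> q * coefficient f q * V q y \<partial>Q)"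

lemma U_section [measurable]: "q \<in> space Q \<Longrightarrow> U q \<in> borel_measurable M"
  using measurable_Pair2[OF U_measurable] by simp

lemma integrable_coefficient:
  assumes "integrable M f" "q \<in> space Q"
  shows "integrable M (\<lambda>y. f y * cnj (U q y))"
proof (rule Bochner_Integration.integrable_bound)
  show "integrable M (\<lambda>y. u q * norm (f y))"
    using assms(1) by simp
  show "(\<lambda>y. f y * cnj (U q y)) \<in> borel_measurable M"
    using assms by measurable
  show "AE y in M. norm (f y * cnj (U q y)) \<le> norm (u q * norm (f y))"
    using U_bound[OF assms(2)]
    by eventually_elim
      (use bound_nonneg[OF assms(2)] in \<open>auto simp: norm_mult mult.commute[of "u q"] intro!: mult_left_mono\<close>)
qed

lemma norm_coefficient_le:
  assumes "integrable M f" "q \<in> space Q"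
  shows "norm (coefficient f q) \<le> u q * (\<integral>y. norm (f y) \<partial>M)"
proof -
  have "norm (coefficient f q) \<le> (\<integral>y. norm (f y * cnj (U q y)) \<partial>M)"
    unfolding coefficient_def by (rule integral_norm_bound)
  also have "\<dots> \<le> (\<integral>y. u q * norm (f y) \<partial>M)"
  proof (rule integral_mono_AE)
    show "integrable M (\<lambda>y. norm (f y * cnj (U q y)))"
      using integrable_coefficient[OF assms] by (rule integrable_norm)
    show "AE y in M. norm (f y * cnj (U q y)) \<le> u q * norm (f y)"
      using U_bound[OF assms(2)]
      by eventually_elim (auto simp: norm_mult mult.commute[of "u q"] intro!: mult_left_mono)
  qed (use assms(1) in simp)
  finally show ?thesis
    by simp
qed

lemma coefficient_measurable:
  assumes "f \<in> borel_measurable M"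
  shows "coefficient f \<in> borel_measurable Q"
proof -
  note [measurable] = assms U_measurable
  have "(\<lambda>(q, y). f y * cnj (U q y)) \<in> borel_measurable (Q \<Otimes>\<^sub>M M)"
    by measurable
  then show ?thesis
    unfolding coefficient_def[abs_def] by (rule M.borel_measurable_lebesgue_integral)
qed

text \<open>
  The central estimate. Integrating over \<open>y\<close> before \<open>q\<close>, the kernel \<open>V q\<close> contributes at most \<open>v q\<close> and
  the coefficient at most \<open>u q\<close> times the norm of \<open>f\<close>, so that the constant \<open>K\<close> can be taken out
  and the integral of the symbol is left.
\<close>

lemma synthesis_integrand:
  assumes f: "integrable M f"
  defines "G \<equiv> \<lambda>(y, q). \<sigma> q * coefficient f q * V q y"
  shows "integrable (M \<Otimes>\<^sub>M Q) G"
    and "(\<integral>p. norm (G p) \<partial>(M \<Otimes>\<^sub>M Q)) \<le> K * (\<integral>q. norm (\<sigma> q) \<partial>Q) * (\<integral>y. norm (f y) \<partial>M)"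
proof -
  let ?F = "\<integral>y. norm (f y) \<partial>M" and ?S = "\<integral>q. norm (\<sigma> q) \<partial>Q"
  have F: "?F \<ge> 0" and S: "?S \<ge> 0"
    by (auto intro: integral_nonneg_AE)
  have [measurable]: "\<sigma> \<in> borel_measurable Q" "coefficient f \<in> borel_measurable Q"
    using symbol f by (auto intro: coefficient_measurable)
  have [measurable]: "(\<lambda>p. V (snd p) (fst p)) \<in> borel_measurable (M \<Otimes>\<^sub>M Q)"
    using measurable_compose[OF measurable_pair_swap' V_measurable] by (simp add: case_prod_beta')
  have G: "G \<in> borel_measurable (M \<Otimes>\<^sub>M Q)"
    unfolding G_def case_prod_beta' by measurable
  have "(\<integral>\<^sup>+p. ennreal (norm (G p)) \<partial>(M \<Otimes>\<^sub>M Q)) = (\<integral>\<^sup>+q. (\<integral>\<^sup>+y. ennreal (norm (G (y, q))) \<partial>M) \<partial>Q)"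
    using G by (subst MQ.nn_integral_snd[symmetric]) (auto simp: case_prod_beta')
  also have "\<dots> \<le> (\<integral>\<^sup>+q. ennreal (K * ?F) * ennreal (norm (\<sigma> q)) \<partial>Q)"
  proof (rule nn_integral_mono)
    fix q assume q: "q \<in> space Q"
    have [measurable]: "V q \<in> borel_measurable M"
      using measurable_Pair2[OF V_measurable q] by simp
    have "(\<integral>\<^sup>+y. ennreal (norm (G (y, q))) \<partial>M)
      = (\<integral>\<^sup>+y. ennreal (norm (\<sigma> q) * norm (coefficient f q)) * ennreal (norm (V q y)) \<partial>M)"
      by (simp add: G_def norm_mult ennreal_mult')
    also have "\<dots> = ennreal (norm (\<sigma> q) * norm (coefficient f q)) * (\<integral>\<^sup>+y. ennreal (norm (V q y)) \<partial>M)"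
      by (rule nn_integral_cmult) measurable
    also have "\<dots> \<le> ennreal (norm (\<sigma> q) * (u q * ?F)) * ennreal (v q)"
      by (intro mult_mono ennreal_leI mult_left_mono norm_coefficient_le[OF f q] V_bound[OF q]) auto
    also have "\<dots> = ennreal (norm (\<sigma> q) * (u q * ?F) * v q)"
      using bound_nonneg[OF q] by (simp add: ennreal_mult'')
    also have "norm (\<sigma> q) * (u q * ?F) * v q = (u q * v q) * ?F * norm (\<sigma> q)"
      by (simp only: mult_ac)
    also have "ennreal \<dots> = ennreal (K * ?F) * ennreal (norm (\<sigma> q))"
      by (simp only: bound_product[OF q] ennreal_mult''[OF norm_ge_zero])
    finally show "(\<integral>\<^sup>+y. ennreal (norm (G (y, q))) \<partial>M) \<le> ennreal (K * ?F) * ennreal (norm (\<sigma> q))" .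
  qed
  also have "\<dots> = ennreal (K * ?F) * (\<integral>\<^sup>+q. ennreal (norm (\<sigma> q)) \<partial>Q)"
    by (rule nn_integral_cmult) measurable
  also have "(\<integral>\<^sup>+q. ennreal (norm (\<sigma> q)) \<partial>Q) = ennreal ?S"
    using symbol by (intro nn_integral_eq_integral) auto
  also have "ennreal (K * ?F) * ennreal ?S = ennreal (K * ?F * ?S)"
    using S by (rule ennreal_mult''[symmetric])
  also have "K * ?F * ?S = K * ?S * ?F"
    by (simp only: mult_ac)
  finally have le: "(\<integral>\<^sup>+p. ennreal (norm (G p)) \<partial>(M \<Otimes>\<^sub>M Q)) \<le> ennreal (K * ?S * ?F)" .
  then show int: "integrable (M \<Otimes>\<^sub>M Q) G"
    using G by (intro integrableI_bounded) (auto intro: le_less_trans)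
  then show "(\<integral>p. norm (G p) \<partial>(M \<Otimes>\<^sub>M Q)) \<le> K * ?S * ?F"
    using le F S bound_product_nonneg
    by (subst (asm) nn_integral_eq_integral) (auto simp: ennreal_le_iff)
qed

lemma AE_integrable_synthesis:
  assumes "integrable M f"
  shows "AE y in M. integrable Q (\<lambda>q. \<sigma> q * coefficient f q * V q y)"
  using MQ.AE_integrable_fst'[OF synthesis_integrand(1)[OF assms]] by simp

lemma integrable_synthesis:
  assumes "integrable M f"
  shows "integrable M (synthesis f)"
  using MQ.integrable_fst'[OF synthesis_integrand(1)[OF assms]]
  by (simp add: synthesis_def[abs_def])

lemma integral_norm_synthesis_le:
  assumes f: "integrable M f"
  shows "(\<integral>y. norm (synthesis f y) \<partial>M) \<le> K * (\<integral>q. norm (\<sigma> q) \<partial>Q) * (\<integral>y. norm (f y) \<partial>M)"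
proof -
  define G where "G = (\<lambda>(y, q). \<sigma> q * coefficient f q * V q y)"
  have G: "integrable (M \<Otimes>\<^sub>M Q) (\<lambda>p. norm (G p))"
    using synthesis_integrand(1)[OF f] unfolding G_def by (rule integrable_norm)
  have "(\<integral>y. norm (synthesis f y) \<partial>M) \<le> (\<integral>y. (\<integral>q. norm (G (y, q)) \<partial>Q) \<partial>M)"
  proof (rule integral_mono)
    show "integrable M (\<lambda>y. norm (synthesis f y))"
      using integrable_synthesis[OF f] by (rule integrable_norm)
    show "integrable M (\<lambda>y. \<integral>q. norm (G (y, q)) \<partial>Q)"
      using MQ.integrable_fst'[OF G] .
    show "norm (synthesis f y) \<le> (\<integral>q. norm (G (y, q)) \<partial>Q)" for y
      using integral_norm_bound[of Q "\<lambda>q. G (y, q)"] by (simp add: synthesis_def G_def)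
  qed
  also have "\<dots> = (\<integral>p. norm (G p) \<partial>(M \<Otimes>\<^sub>M Q))"
    using MQ.integral_fst'[OF G] .
  also have "\<dots> \<le> K * (\<integral>q. norm (\<sigma> q) \<partial>Q) * (\<integral>y. norm (f y) \<partial>M)"
    unfolding G_def by (rule synthesis_integrand(2)[OF f])
  finally show ?thesis .
qed

lemma synthesis_cong_AE:
  assumes f: "integrable M f" and g: "integrable M g" and eq: "AE y in M. f y = g y"
  shows "synthesis f = synthesis g"
proof -
  have "coefficient f q = coefficient g q" if "q \<in> space Q" for q
    unfolding coefficient_def
    using eq integrable_coefficient[OF f that] integrable_coefficient[OF g that]
    by (intro integral_cong_AE) auto
  then show ?thesis
    unfolding synthesis_def[abs_def] by (intro ext Bochner_Integration.integral_cong) auto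
qed

text \<open>
  Additivity can fail at those points where one of the two defining integrals diverges, hence only
  almost everywhere.
\<close>

lemma synthesis_add:
  assumes f: "integrable M f" and g: "integrable M g"
  shows "AE y in M. synthesis (\<lambda>z. f z + g z) y = synthesis f y + synthesis g y"
  using AE_integrable_synthesis[OF f] AE_integrable_synthesis[OF g]
proof eventually_elim
  case (elim y)
  have add: "coefficient (\<lambda>z. f z + g z) q = coefficient f q + coefficient g q" if "q \<in> space Q" for q
    using integrable_coefficient[OF f that] integrable_coefficient[OF g that]
    by (simp add: coefficient_def distrib_right)
  have "synthesis (\<lambda>z. f z + g z) y
    = (\<integral>q. \<sigma> q * coefficient f q * V q y + \<sigma> q * coefficient g q * V q y \<partial>Q)"
    unfolding synthesis_def
    by (intro Bochner_Integration.integral_cong) (auto simp: add algebra_simps)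
  also have "\<dots> = synthesis f y + synthesis g y"
    using elim by (simp add: synthesis_def)
  finally show ?case .
qed

lemma synthesis_scale: "synthesis (\<lambda>z. c * f z) y = c * synthesis f y"
proof -
  have "coefficient (\<lambda>z. c * f z) q = c * coefficient f q" for q
    by (simp add: coefficient_def mult.assoc)
  then have "synthesis (\<lambda>z. c * f z) y = (\<integral>q. c * (\<sigma> q * coefficient f q * V q y) \<partial>Q)"
    by (simp add: synthesis_def mult_ac)
  then show ?thesis
    by (simp add: synthesis_def)
qed

lemma Lp_bounded_linear_synthesis: "Lp_bounded_linear 1 M synthesis"
  unfolding Lp_bounded_linear_def Lp_space_1 Lp_norm_1
proof (intro conjI ballI allI impI)
  show "\<exists>C. \<forall>f\<in>{f. integrable M f}. (\<integral>y. norm (synthesis f y) \<partial>M) \<le> C * (\<integral>y. norm (f y) \<partial>M)"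
    using integral_norm_synthesis_le by blast
next
  fix f g :: "'a \<Rightarrow> complex"
  assume "f \<in> {f. integrable M f}" "g \<in> {f. integrable M f}" "AE y in M. f y = g y"
  then show "AE y in M. synthesis f y = synthesis g y"
    using synthesis_cong_AE[of f g] by simp
qed (auto simp: integrable_synthesis synthesis_add synthesis_scale)

lemma Lp_onorm_synthesis_le: "Lp_onorm 1 M synthesis \<le> K * Lp_norm 1 Q \<sigma>"
  unfolding Lp_onorm_def
proof (rule cSUP_least)
  have "(\<lambda>_. 0) \<in> Lp_space 1 M"
    by (simp add: Lp_space_1)
  then show "Lp_space 1 M \<noteq> {}"
    by blast
next
  fix f assume "f \<in> Lp_space 1 M"
  then have f: "integrable M f"
    by (simp add: Lp_space_1)
  have nonneg: "0 \<le> K * Lp_norm 1 Q \<sigma>" "0 \<le> Lp_norm 1 M f"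
    using bound_product_nonneg by (auto simp: Lp_norm_1 intro!: mult_nonneg_nonneg)
  have le: "Lp_norm 1 M (synthesis f) \<le> K * Lp_norm 1 Q \<sigma> * Lp_norm 1 M f"
    using integral_norm_synthesis_le[OF f] by (simp add: Lp_norm_1)
  show "Lp_norm 1 M (synthesis f) / Lp_norm 1 M f \<le> K * Lp_norm 1 Q \<sigma>"
  proof (cases "Lp_norm 1 M f = 0")
    case False
    then show ?thesis
      using le nonneg by (simp add: divide_le_eq)
  qed (use nonneg in simp)
qed

end

section \<open>The localization operator\<close>

theorem proposition3p3:
  fixes \<alpha> :: real
    and \<phi> \<psi> :: "(real^'d) \<times> real \<Rightarrow> complex"
    and \<sigma> :: "real \<times> ((real^'d) \<times> real) \<Rightarrow> complex"
  assumes "\<alpha> > - 1/2"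
    and "\<sigma> \<in> Lp_space 1 (weinstein_phase_measure \<alpha>)"
    and "\<phi> \<in> Lp_space \<infinity> (weinstein_measure \<alpha>)"
    and "\<psi> \<in> Lp_space 1 (weinstein_measure \<alpha>)"
  shows "(\<forall>f\<in>Lp_space 1 (weinstein_measure \<alpha>). localization_defined \<alpha> \<phi> \<psi> \<sigma> f) \<and>
    Lp_bounded_linear 1 (weinstein_measure \<alpha>) (localization_operator \<alpha> \<phi> \<psi> \<sigma>) \<and>
    Lp_onorm 1 (weinstein_measure \<alpha>) (localization_operator \<alpha> \<phi> \<psi> \<sigma>)
      \<le> Lp_norm \<infinity> (weinstein_measure \<alpha>) \<phi> * Lp_norm 1 (weinstein_measure \<alpha>) \<psi>
         * Lp_norm 1 (weinstein_phase_measure \<alpha>) \<sigma>"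
proof -
  let ?M = "weinstein_measure \<alpha> :: ((real^'d) \<times> real) measure"
  let ?Q = "weinstein_phase_measure \<alpha> :: (real \<times> (real^'d) \<times> real) measure"
  let ?U = "\<lambda>q. weinstein_wavelet \<alpha> \<phi> (fst q) (snd q)"
  let ?V = "\<lambda>q. weinstein_wavelet \<alpha> \<psi> (fst q) (snd q)"
  let ?e = "\<alpha> + 1 + real CARD('d) / 2"
  let ?A = "Lp_norm \<infinity> ?M \<phi>" and ?B = "Lp_norm 1 ?M \<psi>"
  have \<phi>: "\<phi> \<in> borel_measurable ?M"
    using assms(3) by (simp add: Lp_space_def)
  have \<psi>: "integrable ?M \<psi>"
    using assms(4) by (simp add: Lp_space_1)
  have A: "0 \<le> ?A" and B: "0 \<le> ?B"
    by (auto simp: Lp_norm_def)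
  have \<psi>_norm: "(\<integral>\<^sup>+y. ennreal (norm (\<psi> y)) \<partial>?M) = ennreal ?B"
    unfolding Lp_norm_1 using \<psi> by (intro nn_integral_eq_integral) auto
  \<comment> \<open>The two bounds carry inverse powers of the scale, so their product is constant.\<close>
  interpret two_kernel_operator ?M ?Q \<sigma> ?U ?V
    "\<lambda>q. fst q powr (- ?e) * ?A" "\<lambda>q. fst q powr ?e * ?B" "?A * ?B"
  proof (intro two_kernel_operator.intro two_kernel_operator_axioms.intro)
    show "sigma_finite_measure ?M" "sigma_finite_measure ?Q"
      by (rule sigma_finite_weinstein sigma_finite_weinstein_phase)+
    show "integrable ?Q \<sigma>"
      using assms(2) by (simp add: Lp_space_1)
    show "(\<lambda>(q, y). ?U q y) \<in> borel_measurable (?Q \<Otimes>\<^sub>M ?M)"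
      using \<phi> by (rule weinstein_wavelet_phase_measurable)
    show "(\<lambda>(q, y). ?V q y) \<in> borel_measurable (?Q \<Otimes>\<^sub>M ?M)"
      using \<psi> by (intro weinstein_wavelet_phase_measurable) simp
    show "0 \<le> ?A * ?B"
      using A B by simp
    fix q assume "q \<in> space ?Q"
    then have q: "fst q > 0" "snd q \<in> half_space"
      by (auto simp: space_weinstein_phase)
    show "AE y in ?M. norm (?U q y) \<le> fst q powr (- ?e) * ?A"
      using assms(1) \<phi> Lp_infinity_AE_bound[OF assms(3)] q by (rule AE_norm_weinstein_wavelet_le)
    show "(\<integral>\<^sup>+y. ennreal (norm (?V q y)) \<partial>?M) \<le> ennreal (fst q powr ?e * ?B)"
      using nn_integral_norm_weinstein_wavelet_le[OF assms(1) borel_measurable_integrable[OF \<psi>] q]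
      by (simp add: \<psi>_norm ennreal_mult')
    show "0 \<le> fst q powr (- ?e) * ?A" "0 \<le> fst q powr ?e * ?B"
      using A B by auto
    have "fst q powr (- ?e) * fst q powr ?e = 1"
      using q by (simp only: powr_minus) simp
    moreover have "fst q powr (- ?e) * ?A * (fst q powr ?e * ?B)
        = (fst q powr (- ?e) * fst q powr ?e) * (?A * ?B)"
      by (simp only: mult_ac)
    ultimately show "fst q powr (- ?e) * ?A * (fst q powr ?e * ?B) = ?A * ?B"
      by (simp only: mult_1)
  qed
  have transform: "weinstein_transform \<alpha> \<phi> f a x = coefficient f (a, x)" for f a x
    by (simp add: weinstein_transform_def coefficient_def)
  have operator: "localization_operator \<alpha> \<phi> \<psi> \<sigma> = synthesis"
    by (intro ext) (simp add: localization_operator_def synthesis_def transform case_prod_beta')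
  have "localization_defined \<alpha> \<phi> \<psi> \<sigma> f" if "integrable ?M f" for f
    unfolding localization_defined_def
  proof (intro conjI allI impI ballI)
    fix a :: real and x :: "(real^'d) \<times> real"
    assume "0 < a" "x \<in> half_space"
    then show "integrable ?M (\<lambda>y. f y * cnj (weinstein_wavelet \<alpha> \<phi> a x y))"
      using integrable_coefficient[OF that, of "(a, x)"] by (simp add: space_weinstein_phase)
  next
    show "AE y in ?M. integrable ?Q
        (\<lambda>(a, x). \<sigma> (a, x) * weinstein_transform \<alpha> \<phi> f a x * weinstein_wavelet \<alpha> \<psi> a x y)"
      using AE_integrable_synthesis[OF that] by (simp add: transform case_prod_beta')
  qed
  then show ?thesis
    using Lp_bounded_linear_synthesis Lp_onorm_synthesis_le by (simp add: operator Lp_space_1)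
qed

end
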